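(* The function $I(\varrho)=\log d-S(\varrho)$ (for $\varrho$ a state on $\mathbb{C}^d$, $d\geq 1$) is non-increasing under noisy operations and asymptotically continuous, and it is the unique such function in the following sense. Let $f$ be a real-valued function defined on the states of all finite-dimensional systems which is non-increasing under noisy operations, i.e. $f(\Lambda(\varrho))\le f(\varrho)$ for every state $\varrho$ and every noisy operation $\Lambda$, and which is asymptotically continuous. Suppose that the regularization $f^\infty(\varrho)=\lim_{n\to\infty}\frac1n f(\varrho^{\otimes n})$ exists for every state $\varrho$ and that $f^\infty(\pi)>0$, where $\pi$ is a pure state of one qubit. Then, with the constant $a=1/f^\infty(\pi)$, $$a\,f^\infty(\varrho)=I(\varrho)$$ for every state $\varrho$.
   Context: Logarithms are base $2$ and $S(\varrho)=-\mathrm{Tr}\,\varrho\log\varrho$ is the von Neumann entropy. A state on $\mathbb{C}^d$ is a positive semidefinite operator of trace $1$. The maximally mixed state on $\mathbb{C}^K$ is $\tau_K=\mathbb{1}/K$. Noisy operations (NO) are the maps on states obtained as finite compositions of the following: (1) unitary transformations; (2) adding an ancilla in a maximally mixed state, $\varrho\mapsto\varrho\otimes\tau_K$, for an arbitrary finite dimension $K$; (3) discarding a subsystem, i.e. taking the partial trace over a tensor factor of the Hilbert space (for any identification of the Hilbert space with a tensor product $\mathbb{C}^a\otimes\mathbb{C}^b$). Asymptotic continuity: $f$ is asymptotically continuous if, for any sequences of states $\varrho_n,\sigma_n$ on $\mathbb{C}^{d_n}$ with $d_n\to\infty$ (the number of qubits of such a system being $\log d_n$) and $\|\varrho_n-\sigma_n\|\to0$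 (trace norm), one has $$\frac{|f(\varrho_n)-f(\sigma_n)|}{\log d_n}\to0 .$$ *)

theory Defs
  imports Complex_Main "Jordan_Normal_Form.Schur_Decomposition"
begin

definition is_unitary :: "nat \<Rightarrow> complex mat \<Rightarrow> bool" where
  "is_unitary d U \<longleftrightarrow>
     U \<in> carrier_mat d d \<and> mat_adjoint U * U = 1\<^sub>m d \<and> U * mat_adjoint U = 1\<^sub>m d"

definition mat_trace :: "complex mat \<Rightarrow> complex" where
  "mat_trace A = (\<Sum>i<dim_row A. A $$ (i, i))"

definition positive_semidefinite :: "complex mat \<Rightarrow> bool" where
  "positive_semidefinite A \<longleftrightarrow>
     square_mat A \<and> mat_adjoint A = A \<and>
     (\<forall>v \<in> carrier_vec (dim_row A). 0 \<le> Re ((A *\<^sub>v v) \<bullet>c v))"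

(* The trace condition forces d >= 1. *)
definition is_state :: "nat \<Rightarrow> complex mat \<Rightarrow> bool" where
  "is_state d \<rho> \<longleftrightarrow> \<rho> \<in> carrier_mat d d \<and> positive_semidefinite \<rho> \<and> mat_trace \<rho> = 1"

definition pure_state :: "nat \<Rightarrow> complex mat \<Rightarrow> bool" where
  "pure_state d \<rho> \<longleftrightarrow>
     (\<exists>\<psi> \<in> carrier_vec d. \<psi> \<bullet>c \<psi> = 1 \<and> \<rho> = mat d d (\<lambda>(i, j). \<psi> $ i * cnj (\<psi> $ j)))"

(* Functional calculus f(A) for a Hermitian matrix A, through a unitary diagonalisation;
   the result B is the same for every diagonalisation of A, and unspecified if A is
   not Hermitian. *)
definition mat_fun :: "(real \<Rightarrow> real) \<Rightarrow> complex mat \<Rightarrow> complex mat" where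
  "mat_fun f A =
     (SOME B. \<exists>U l. is_unitary (dim_row A) U \<and>
        A = U * mat_diag (dim_row A) (\<lambda>i. complex_of_real (l i)) * mat_adjoint U \<and>
        B = U * mat_diag (dim_row A) (\<lambda>i. complex_of_real (f (l i))) * mat_adjoint U)"

(* S = - Tr (rho log rho). The value assigned to log 0 is immaterial, as it is multiplied
   by the eigenvalue 0: this is the convention 0 log 0 = 0. *)
definition von_neumann_entropy :: "complex mat \<Rightarrow> real" where
  "von_neumann_entropy \<rho> = - Re (mat_trace (\<rho> * mat_fun (log 2) \<rho>))"

definition trace_norm :: "complex mat \<Rightarrow> real" where
  "trace_norm A = Re (mat_trace (mat_fun sqrt (mat_adjoint A * A)))"

(* Kronecker product: the basis vector e_i (x) e_k of C^a (x) C^b has index i * b + k. *)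
definition tensor :: "complex mat \<Rightarrow> complex mat \<Rightarrow> complex mat" where
  "tensor A B = mat (dim_row A * dim_row B) (dim_col A * dim_col B)
     (\<lambda>(i, j). A $$ (i div dim_row B, j div dim_col B) * B $$ (i mod dim_row B, j mod dim_col B))"

primrec tensor_power :: "complex mat \<Rightarrow> nat \<Rightarrow> complex mat" where
  "tensor_power \<rho> 0 = 1\<^sub>m 1"
| "tensor_power \<rho> (Suc n) = tensor \<rho> (tensor_power \<rho> n)"

(* Partial trace over the second factor of C^a (x) C^b, in the same basis ordering. *)
definition partial_trace :: "nat \<Rightarrow> nat \<Rightarrow> complex mat \<Rightarrow> complex mat" where
  "partial_trace a b \<rho> = mat a a (\<lambda>(i, j). \<Sum>k<b. \<rho> $$ (i * b + k, j * b + k))"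

definition maximally_mixed :: "nat \<Rightarrow> complex mat" where
  "maximally_mixed K = (1 / of_nat K) \<cdot>\<^sub>m 1\<^sub>m K"

(* noisy_op d e L: L is a noisy operation from states on C^d to states on C^e; L is only
   meaningful on those states. In the rule discard, V is the identification of C^(ab) with
   C^a (x) C^b; discarding the first factor instead is the same rule with the factors
   exchanged, V being followed by the swap of the two factors. *)
inductive noisy_op :: "nat \<Rightarrow> nat \<Rightarrow> (complex mat \<Rightarrow> complex mat) \<Rightarrow> bool" where
  unitary: "is_unitary d U \<Longrightarrow> noisy_op d d (\<lambda>\<rho>. U * \<rho> * mat_adjoint U)"
| ancilla: "K \<ge> 1 \<Longrightarrow> noisy_op d (d * K) (\<lambda>\<rho>. tensor \<rho> (maximally_mixed K))"
| discard: "is_unitary (a * b) V \<Longrightarrow>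
    noisy_op (a * b) a (\<lambda>\<rho>. partial_trace a b (V * \<rho> * mat_adjoint V))"
| compose: "noisy_op c d L \<Longrightarrow> noisy_op d e M \<Longrightarrow> noisy_op c e (\<lambda>\<rho>. M (L \<rho>))"

(* A real function of the states of all finite-dimensional systems is a function on complex
   matrices of which only the values on states are ever used. *)
definition nonincreasing_under_NO :: "(complex mat \<Rightarrow> real) \<Rightarrow> bool" where
  "nonincreasing_under_NO f \<longleftrightarrow>
     (\<forall>d e L \<rho>. noisy_op d e L \<longrightarrow> is_state d \<rho> \<longrightarrow> f (L \<rho>) \<le> f \<rho>)"

definition asymptotically_continuous :: "(complex mat \<Rightarrow> real) \<Rightarrow> bool" where
  "asymptotically_continuous f \<longleftrightarrow>
     (\<forall>(d :: nat \<Rightarrow> nat) \<rho> \<sigma>.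
        (\<forall>n. is_state (d n) (\<rho> n) \<and> is_state (d n) (\<sigma> n)) \<longrightarrow>
        filterlim d at_top sequentially \<longrightarrow>
        (\<lambda>n. trace_norm (\<rho> n - \<sigma> n)) \<longlonglongrightarrow> 0 \<longrightarrow>
        (\<lambda>n. \<bar>f (\<rho> n) - f (\<sigma> n)\<bar> / log 2 (real (d n))) \<longlonglongrightarrow> 0)"

definition regularization_exists :: "(complex mat \<Rightarrow> real) \<Rightarrow> complex mat \<Rightarrow> bool" where
  "regularization_exists f \<rho> \<longleftrightarrow> convergent (\<lambda>n. f (tensor_power \<rho> n) / real n)"

definition regularization :: "(complex mat \<Rightarrow> real) \<Rightarrow> complex mat \<Rightarrow> real" where
  "regularization f \<rho> = lim (\<lambda>n. f (tensor_power \<rho> n) / real n)"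

definition information :: "complex mat \<Rightarrow> real" where
  "information \<rho> = log 2 (real (dim_row \<rho>)) - von_neumann_entropy \<rho>"

end

theory Submission
  imports Defs "Jordan_Normal_Form.Spectral_Radius"
begin

text \<open>
  Passing from a state to its diagonal in any orthonormal basis increases the entropy, by concavity
  of \<open>- x log x\<close>. In a product basis adapted to the reduced state this yields
  \<open>S(\<rho>) \<le> S(Tr_B \<rho>) + log b\<close>, so that \<open>I\<close> cannot increase when a subsystem is discarded; in the
  eigenbasis of \<open>\<sigma>\<close> it bounds \<open>S(\<rho>) - S(\<sigma>)\<close> by an entropy difference of two classical
  distributions at distance at most the trace norm of \<open>\<rho> - \<sigma>\<close>.

  For uniqueness, an ancilla, a permutation of basis vectors and a partial trace suffice to
  convert, with vanishing error, \<open>n\<close> copies of \<open>\<rho>\<close> into \<open>n (I(\<rho>) - \<epsilon>)\<close> pure qubits and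
  \<open>n (I(\<rho>) + \<epsilon>)\<close> pure qubits into \<open>n\<close> copies of \<open>\<rho>\<close>: by Chebyshev's inequality nearly all the
  weight of the n-fold tensor power of \<open>\<rho>\<close> lies on eigenvalues within a factor \<open>2 powr (n \<epsilon>)\<close> of
  \<open>2 powr (- n S(\<rho>))\<close>. Monotonicity and continuity of \<open>f\<close> turn the two conversions into
  \<open>f\<^sup>\<infinity>(\<pi>) (I(\<rho>) - \<epsilon>) \<le> f\<^sup>\<infinity>(\<rho>) \<le> f\<^sup>\<infinity>(\<pi>) (I(\<rho>) + \<epsilon>)\<close>.
\<close>

section \<open>Unitary diagonalization\<close>

lemma dim_mat_adjoint [simp]:
  "dim_row (mat_adjoint A) = dim_col A" "dim_col (mat_adjoint A) = dim_row A"
  by (simp_all add: mat_adjoint_def)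

lemma mat_adjoint_carrier [simp]:
  "A \<in> carrier_mat n m \<Longrightarrow> mat_adjoint A \<in> carrier_mat m n"
  by auto

lemma mat_adjoint_index [simp]:
  fixes A :: "complex mat"
  assumes "i < dim_col A" "j < dim_row A"
  shows "mat_adjoint A $$ (i, j) = cnj (A $$ (j, i))"
  using assms by (simp add: mat_adjoint_def mat_of_rows_index)

lemma mat_adjoint_adjoint [simp]: "mat_adjoint (mat_adjoint A) = (A :: complex mat)"
  by (rule eq_matI) auto

lemma mat_mult_index:
  fixes A :: "'a :: semiring_0 mat"
  assumes "A \<in> carrier_mat n m" "B \<in> carrier_mat m p" "i < n" "j < p"
  shows "(A * B) $$ (i, j) = (\<Sum>k<m. A $$ (i, k) * B $$ (k, j))"
  using assms by (auto simp: scalar_prod_def lessThan_atLeast0)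

lemma mult_square_carrier [simp]:
  "A \<in> carrier_mat d d \<Longrightarrow> B \<in> carrier_mat d d \<Longrightarrow> A * B \<in> carrier_mat d d"
  by (rule mult_carrier_mat)

lemma mat_adjoint_mult:
  fixes A :: "complex mat"
  assumes "A \<in> carrier_mat n m" "B \<in> carrier_mat m p"
  shows "mat_adjoint (A * B) = mat_adjoint B * mat_adjoint A"
proof (rule eq_matI)
  fix i j assume ij: "i < dim_row (mat_adjoint B * mat_adjoint A)"
    "j < dim_col (mat_adjoint B * mat_adjoint A)"
  then have "(A * B) $$ (j, i) = (\<Sum>k<m. A $$ (j, k) * B $$ (k, i))"
    using assms by (intro mat_mult_index) auto
  moreover have "(mat_adjoint B * mat_adjoint A) $$ (i, j) =
      (\<Sum>k<m. mat_adjoint B $$ (i, k) * mat_adjoint A $$ (k, j))"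
    using assms ij by (intro mat_mult_index) auto
  ultimately show "mat_adjoint (A * B) $$ (i, j) = (mat_adjoint B * mat_adjoint A) $$ (i, j)"
    using assms ij by (auto intro!: sum.cong)
qed (use assms in auto)

lemma mat_adjoint_one [simp]: "mat_adjoint (1\<^sub>m n) = (1\<^sub>m n :: complex mat)"
  by (rule eq_matI) auto

lemma mat_adjoint_diag_real [simp]:
  "mat_adjoint (mat_diag n (\<lambda>i. complex_of_real (l i))) = mat_diag n (\<lambda>i. complex_of_real (l i))"
  by (rule eq_matI) (auto simp: mat_diag_def)

lemma is_unitaryI:
  assumes "U \<in> carrier_mat d d" "mat_adjoint U * U = 1\<^sub>m d"
  shows "is_unitary d U"
  using assms mat_mult_left_right_inverse[of "mat_adjoint U" d U] by (auto simp: is_unitary_def)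

lemma is_unitaryD:
  assumes "is_unitary d U"
  shows "U \<in> carrier_mat d d" "mat_adjoint U * U = 1\<^sub>m d" "U * mat_adjoint U = 1\<^sub>m d"
  using assms by (auto simp: is_unitary_def)

lemma is_unitary_one [simp]: "is_unitary d (1\<^sub>m d)"
  by (intro is_unitaryI) auto

lemma is_unitary_adjoint: "is_unitary d U \<Longrightarrow> is_unitary d (mat_adjoint U)"
  by (auto simp: is_unitary_def)

lemma is_unitary_mult:
  assumes "is_unitary d U" "is_unitary d V"
  shows "is_unitary d (U * V)"
proof (rule is_unitaryI)
  note U = is_unitaryD[OF assms(1)] and V = is_unitaryD[OF assms(2)]
  show "U * V \<in> carrier_mat d d" using U V by auto
  have "mat_adjoint (U * V) * (U * V) = mat_adjoint V * (mat_adjoint U * U) * V"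
    using U(1) V(1)
    by (simp add: mat_adjoint_mult[of _ d d _ d] assoc_mult_mat[of _ d d _ d _ d])
  then show "mat_adjoint (U * V) * (U * V) = 1\<^sub>m d" using U V by simp
qed

lemma is_unitary_row_norm:
  assumes "is_unitary d U" "i < d"
  shows "(\<Sum>j<d. (cmod (U $$ (i, j)))\<^sup>2) = 1"
proof -
  note U = is_unitaryD[OF assms(1)]
  have "(U * mat_adjoint U) $$ (i, i) = (\<Sum>j<d. U $$ (i, j) * mat_adjoint U $$ (j, i))"
    using U assms by (intro mat_mult_index) auto
  also have "\<dots> = (\<Sum>j<d. U $$ (i, j) * cnj (U $$ (i, j)))"
    using U assms by (intro sum.cong) auto
  also have "\<dots> = complex_of_real (\<Sum>j<d. (cmod (U $$ (i, j)))\<^sup>2)"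
    by (simp only: of_real_sum complex_norm_square)
  finally show ?thesis using U assms by (metis index_one_mat(1) of_real_eq_1_iff)
qed

lemma is_unitary_col_norm:
  assumes "is_unitary d U" "j < d"
  shows "(\<Sum>i<d. (cmod (U $$ (i, j)))\<^sup>2) = 1"
proof -
  have "(\<Sum>i<d. (cmod (U $$ (i, j)))\<^sup>2) = (\<Sum>i<d. (cmod (mat_adjoint U $$ (j, i)))\<^sup>2)"
    using is_unitaryD[OF assms(1)] assms(2) by (intro sum.cong) auto
  then show ?thesis
    using is_unitary_row_norm[OF is_unitary_adjoint[OF assms(1)] assms(2)] by simp
qed

definition unitary_diag :: "nat \<Rightarrow> complex mat \<Rightarrow> (nat \<Rightarrow> real) \<Rightarrow> complex mat" where
  "unitary_diag d U l = U * mat_diag d (\<lambda>i. complex_of_real (l i)) * mat_adjoint U"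

lemma unitary_diag_carrier [simp]:
  "U \<in> carrier_mat d d \<Longrightarrow> unitary_diag d U l \<in> carrier_mat d d"
  by (simp add: unitary_diag_def)

lemma dim_unitary_diag [simp]:
  "dim_row (unitary_diag d U l) = dim_row U" "dim_col (unitary_diag d U l) = dim_row U"
  by (simp_all add: unitary_diag_def)

lemma unitary_diag_cong:
  "(\<And>i. i < d \<Longrightarrow> l i = l' i) \<Longrightarrow> unitary_diag d U l = unitary_diag d U l'"
  unfolding unitary_diag_def mat_diag_def
  by (rule arg_cong[where f = "\<lambda>D. U * D * mat_adjoint U"], rule eq_matI) auto

lemma unitary_diag_index:
  assumes "U \<in> carrier_mat d d" "i < d" "j < d"
  shows "unitary_diag d U l $$ (i, j) = (\<Sum>k<d. U $$ (i, k) * of_real (l k) * cnj (U $$ (j, k)))"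
proof -
  have "unitary_diag d U l $$ (i, j) =
     (\<Sum>k<d. (U * mat_diag d (\<lambda>i. complex_of_real (l i))) $$ (i, k) * mat_adjoint U $$ (k, j))"
    unfolding unitary_diag_def using assms by (intro mat_mult_index) auto
  then show ?thesis using assms by (auto intro!: sum.cong simp: mat_diag_mult_right[of _ d])
qed

lemma unitary_diag_diagonal:
  assumes "U \<in> carrier_mat d d" "i < d"
  shows "unitary_diag d U l $$ (i, i) = of_real (\<Sum>k<d. (cmod (U $$ (i, k)))\<^sup>2 * l k)"
proof -
  have "U $$ (i, k) * of_real (l k) * cnj (U $$ (i, k)) = of_real ((cmod (U $$ (i, k)))\<^sup>2 * l k)" for k
    by (simp only: of_real_mult complex_norm_square) simp
  then show ?thesis using assms by (simp only: unitary_diag_index of_real_sum)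
qed

lemma unitary_diag_one: "unitary_diag d (1\<^sub>m d) l = mat_diag d (\<lambda>i. complex_of_real (l i))"
  by (simp add: unitary_diag_def right_mult_one_mat[OF mat_diag_dim] left_mult_one_mat[OF mat_diag_dim])

lemma mat_adjoint_unitary_diag:
  assumes "U \<in> carrier_mat d d"
  shows "mat_adjoint (unitary_diag d U l) = unitary_diag d U l"
proof -
  have D: "mat_diag d (\<lambda>i. complex_of_real (l i)) \<in> carrier_mat d d" by simp
  show ?thesis unfolding unitary_diag_def using assms D
    by (simp add: mat_adjoint_mult[of _ d d _ d] assoc_mult_mat[of _ d d _ d _ d])
qed

lemma conj_unitary_diag:
  assumes "V \<in> carrier_mat d d" "U \<in> carrier_mat d d"
  shows "V * unitary_diag d U l * mat_adjoint V = unitary_diag d (V * U) l"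
proof -
  have D: "mat_diag d (\<lambda>i. complex_of_real (l i)) \<in> carrier_mat d d" by simp
  show ?thesis unfolding unitary_diag_def using assms D
    by (simp add: mat_adjoint_mult[of _ d d _ d] assoc_mult_mat[of _ d d _ d _ d])
qed

lemma unitary_diag_mult:
  assumes "is_unitary d U"
  shows "unitary_diag d U l * unitary_diag d U m = unitary_diag d U (\<lambda>i. l i * m i)"
proof -
  note U = is_unitaryD[OF assms]
  let ?D = "\<lambda>l. mat_diag d (\<lambda>i. complex_of_real (l i))"
  have D: "?D l \<in> carrier_mat d d" for l by simp
  have "unitary_diag d U l * unitary_diag d U m
      = U * ?D l * (mat_adjoint U * U) * ?D m * mat_adjoint U"
    unfolding unitary_diag_def using U(1) D
    by (simp add: assoc_mult_mat[of _ d d _ d _ d])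
  also have "\<dots> = U * (?D l * ?D m) * mat_adjoint U"
    using U(1) D unfolding U(2)
    by (simp add: assoc_mult_mat[of _ d d _ d _ d] right_mult_one_mat[of _ d d] del: mat_diag_diag)
  also have "?D l * ?D m = ?D (\<lambda>i. l i * m i)" by simp
  finally show ?thesis by (simp add: unitary_diag_def)
qed

lemma unitary_diag_diff:
  assumes "is_unitary d U"
  shows "unitary_diag d U l - unitary_diag d U m = unitary_diag d U (\<lambda>i. l i - m i)"
  using is_unitaryD(1)[OF assms]
  by (intro eq_matI)
    (auto simp: unitary_diag_index sum_subtractf[symmetric] algebra_simps intro!: sum.cong)

lemma mat_trace_unitary_diag:
  assumes "is_unitary d U"
  shows "mat_trace (unitary_diag d U l) = of_real (\<Sum>k<d. l k)"
proof -
  note U = is_unitaryD[OF assms]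
  have "mat_trace (unitary_diag d U l) = of_real (\<Sum>i<d. \<Sum>k<d. (cmod (U $$ (i, k)))\<^sup>2 * l k)"
    using U(1)
    by (simp add: mat_trace_def unitary_diag_diagonal)
  also have "(\<Sum>i<d. \<Sum>k<d. (cmod (U $$ (i, k)))\<^sup>2 * l k)
      = (\<Sum>k<d. (\<Sum>i<d. (cmod (U $$ (i, k)))\<^sup>2) * l k)"
    by (subst sum.swap) (simp add: sum_distrib_right)
  also have "\<dots> = (\<Sum>k<d. l k)" using is_unitary_col_norm[OF assms] by simp
  finally show ?thesis .
qed

lemma conj_conj_unitary:
  assumes "is_unitary d W" "A \<in> carrier_mat d d"
  shows "W * (mat_adjoint W * A * W) * mat_adjoint W = A"
proof -
  note W = is_unitaryD[OF assms(1)]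
  have "W * (mat_adjoint W * A * W) * mat_adjoint W
      = (W * mat_adjoint W) * A * (W * mat_adjoint W)"
    using W(1) assms(2) by (simp add: assoc_mult_mat[of _ d d _ d _ d])
  then show ?thesis using W(3) assms(2) by simp
qed

section \<open>The spectral theorem\<close>

lemma unitary_completion:
  fixes v :: "complex vec"
  assumes v: "v \<in> carrier_vec n" and v0: "v \<noteq> 0\<^sub>v n"
  obtains W c where "is_unitary n W" "c \<noteq> 0" "col W 0 = c \<cdot>\<^sub>v v"
proof -
  interpret cof_vec_space n "TYPE(complex)" .
  define b where "b = basis_completion v"
  define ws where "ws = gram_schmidt n b"
  from basis_completion[OF v v0, folded b_def]
  have dist_b: "distinct b" and indep: "\<not> lin_dep (set b)" and b: "set b \<subseteq> carrier_vec n"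
    and hdb: "hd b = v" and len_b: "length b = n" by auto
  have n: "n \<noteq> 0" using v v0 by auto
  then obtain vs where bv: "b = v # vs" using len_b hdb by (cases b) auto
  have hdws: "hd ws = v" using gram_schmidt_hd[OF v, of vs] unfolding ws_def bv by simp
  from gram_schmidt_result[OF b dist_b indep refl, folded ws_def] len_b
  have ws: "set ws \<subseteq> carrier_vec n" "corthogonal ws" "length ws = n" by auto
  then have ws0: "ws ! 0 = v" using hdws n by (cases ws) auto
  have wsc: "ws ! i \<in> carrier_vec n" if "i < n" for i using ws that by auto
  define r where "r i = sqrt (Re (ws ! i \<bullet>c ws ! i))" for i
  have sq: "ws ! i \<bullet>c ws ! i = of_real ((r i)\<^sup>2)" "r i \<noteq> 0" if i: "i < n" for i
  proof -
    have pos: "ws ! i \<bullet>c ws ! i > 0"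
      using corthogonalD[OF ws(2), of i i] i ws(3) conjugate_square_ge_0_vec[of "ws ! i"]
      by (simp add: order_less_le)
    then have "Re (ws ! i \<bullet>c ws ! i) > 0" "Im (ws ! i \<bullet>c ws ! i) = 0"
      by (simp_all add: less_complex_def)
    then show "ws ! i \<bullet>c ws ! i = of_real ((r i)\<^sup>2)" "r i \<noteq> 0"
      by (simp_all add: r_def complex_eq_iff)
  qed
  define W where "W = mat n n (\<lambda>(i, j). ws ! j $ i / of_real (r j))"
  have W: "W \<in> carrier_mat n n" by (simp add: W_def)
  have "mat_adjoint W * W = 1\<^sub>m n"
  proof (rule eq_matI)
    fix i j assume ij: "i < dim_row (1\<^sub>m n :: complex mat)" "j < dim_col (1\<^sub>m n :: complex mat)"
    then have ij: "i < n" "j < n" by auto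
    have "(mat_adjoint W * W) $$ (i, j) = (\<Sum>k<n. mat_adjoint W $$ (i, k) * W $$ (k, j))"
      using W ij by (intro mat_mult_index) auto
    also have "\<dots> = (\<Sum>k<n. ws ! j $ k * cnj (ws ! i $ k)) / (of_real (r i) * of_real (r j))"
      using W ij by (auto simp: W_def sum_divide_distrib intro!: sum.cong)
    also have "(\<Sum>k<n. ws ! j $ k * cnj (ws ! i $ k)) = ws ! j \<bullet>c ws ! i"
      using wsc[OF ij(1)] wsc[OF ij(2)] by (simp add: scalar_prod_def lessThan_atLeast0)
    finally show "(mat_adjoint W * W) $$ (i, j) = (1\<^sub>m n) $$ (i, j)"
      using corthogonalD[OF ws(2), of j i] sq[OF ij(1)] ij ws(3)
      by (cases "i = j") (auto simp: power2_eq_square)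
  qed (use W in auto)
  then have "is_unitary n W" using W by (intro is_unitaryI)
  moreover have "col W 0 = complex_of_real (1 / r 0) \<cdot>\<^sub>v v"
    using n hdws ws(3) v by (intro eq_vecI) (auto simp: W_def ws0)
  moreover have "complex_of_real (1 / r 0) \<noteq> 0" using sq(2)[of 0] n by simp
  ultimately show ?thesis using that by blast
qed

lemma is_unitary_extend:
  assumes "is_unitary n V"
  shows "is_unitary (Suc n) (mat (Suc n) (Suc n)
    (\<lambda>(i, j). if i = 0 \<or> j = 0 then (if i = j then 1 else 0) else V $$ (i - 1, j - 1)))"
    (is "is_unitary _ ?E")
proof (rule is_unitaryI)
  note V = is_unitaryD[OF assms]
  show "?E \<in> carrier_mat (Suc n) (Suc n)" by simp
  show "mat_adjoint ?E * ?E = 1\<^sub>m (Suc n)"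
  proof (rule eq_matI)
    fix i j assume "i < dim_row (1\<^sub>m (Suc n) :: complex mat)" "j < dim_col (1\<^sub>m (Suc n) :: complex mat)"
    then have ij: "i < Suc n" "j < Suc n" by auto
    have "(mat_adjoint ?E * ?E) $$ (i, j) = (\<Sum>k<Suc n. mat_adjoint ?E $$ (i, k) * ?E $$ (k, j))"
      using ij by (intro mat_mult_index) auto
    also have "\<dots> = (\<Sum>k<Suc n. cnj (?E $$ (k, i)) * ?E $$ (k, j))"
      using ij by (intro sum.cong) auto
    also have "\<dots> = cnj (?E $$ (0, i)) * ?E $$ (0, j)
        + (\<Sum>k<n. cnj (?E $$ (Suc k, i)) * ?E $$ (Suc k, j))"
      by (rule sum.lessThan_Suc_shift)
    also have "\<dots> = (1\<^sub>m (Suc n)) $$ (i, j)"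
    proof (cases "i = 0 \<or> j = 0")
      case True
      then show ?thesis using ij by auto
    next
      case False
      then have ij': "i - 1 < n" "j - 1 < n" using ij by auto
      have "(\<Sum>k<n. cnj (?E $$ (Suc k, i)) * ?E $$ (Suc k, j))
          = (\<Sum>k<n. mat_adjoint V $$ (i - 1, k) * V $$ (k, j - 1))"
        using False ij ij' V(1) by (intro sum.cong) auto
      also have "\<dots> = (mat_adjoint V * V) $$ (i - 1, j - 1)"
        using V(1) ij' by (intro mat_mult_index[symmetric]) auto
      finally show ?thesis using False ij ij' V(2) by (auto simp del: mat_adjoint_index)
    qed
    finally show "(mat_adjoint ?E * ?E) $$ (i, j) = (1\<^sub>m (Suc n)) $$ (i, j)" .
  qed auto
qed

theorem hermitian_diagonalization:
  assumes "A \<in> carrier_mat n n" "mat_adjoint A = A"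
  shows "\<exists>U l. is_unitary n U \<and> A = unitary_diag n U l"
  using assms
proof (induction n arbitrary: A)
  case 0
  then have "A = unitary_diag 0 (1\<^sub>m 0) l" for l by (intro eq_matI) (auto simp: unitary_diag_def)
  then show ?case using is_unitary_one by blast
next
  case (Suc n)
  let ?N = "Suc n"
  from spectrum_non_empty[OF Suc.prems(1)] obtain e v where "eigenvector A v e"
    by (auto simp: spectrum_def eigenvalue_def)
  then have v: "v \<in> carrier_vec ?N" "v \<noteq> 0\<^sub>v ?N" "A *\<^sub>v v = e \<cdot>\<^sub>v v"
    using Suc.prems(1) by (auto simp: eigenvector_def)
  obtain W c where W: "is_unitary ?N W" "c \<noteq> 0" "col W 0 = c \<cdot>\<^sub>v v"
    using unitary_completion[OF v(1,2)] by blast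
  note Wd = is_unitaryD[OF W(1)]
  define B where "B = mat_adjoint W * A * W"
  have B: "B \<in> carrier_mat ?N ?N" using Wd(1) Suc.prems(1) by (simp add: B_def)
  have AB: "A = W * B * mat_adjoint W"
    unfolding B_def using conj_conj_unitary[OF W(1) Suc.prems(1)] by simp
  have hB: "mat_adjoint B = B"
    unfolding B_def using Wd(1) Suc.prems
    by (simp add: mat_adjoint_mult[of _ ?N ?N _ ?N] assoc_mult_mat[of _ ?N ?N _ ?N _ ?N])
  have herm: "B $$ (i, j) = cnj (B $$ (j, i))" if "i < ?N" "j < ?N" for i j
    using mat_adjoint_index[of i B j] that B hB by simp
  have B0: "B $$ (i, 0) = (if i = 0 then e else 0)" if "i < ?N" for i
  proof -
    have "col B 0 = mat_adjoint W *\<^sub>v (A *\<^sub>v col W 0)"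
      unfolding B_def using Wd(1) Suc.prems(1)
      by (subst col_mult2[of _ ?N ?N _ ?N]) (auto intro!: assoc_mult_mat_vec[of _ ?N ?N _ ?N] col_carrier_vec[of 0 ?N W ?N])
    also have "A *\<^sub>v col W 0 = e \<cdot>\<^sub>v col W 0"
      unfolding W(3) using v Suc.prems(1)
      by (simp add: mult_mat_vec[of _ ?N ?N] smult_smult_assoc mult.commute)
    also have "mat_adjoint W *\<^sub>v (e \<cdot>\<^sub>v col W 0) = e \<cdot>\<^sub>v (mat_adjoint W *\<^sub>v col W 0)"
      using Wd(1) col_carrier_vec[of 0 ?N W ?N] by (intro mult_mat_vec[of _ ?N ?N]) auto
    also have "mat_adjoint W *\<^sub>v col W 0 = col (mat_adjoint W * W) 0"
      using Wd(1) by (subst col_mult2[of _ ?N ?N _ ?N]) auto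
    finally have "col B 0 $ i = (e \<cdot>\<^sub>v col (1\<^sub>m ?N) 0) $ i" using Wd(2) by simp
    then show ?thesis using that B by (auto split: if_splits)
  qed
  have "e = cnj e" using herm[of 0 0] unfolding B0[of 0, simplified] by simp
  then have "Im e = - Im e" by (metis cnj.sel(2))
  then have Bdiag: "B $$ (0, 0) = of_real (Re e)" using B0[of 0] by (simp add: complex_eq_iff)
  have Brow: "B $$ (0, j) = 0" if "0 < j" "j < ?N" for j
    using herm[of 0 j] that unfolding B0[OF that(2)] by simp
  define C where "C = mat n n (\<lambda>(i, j). B $$ (Suc i, Suc j))"
  have "C \<in> carrier_mat n n" by (simp add: C_def)
  moreover have "mat_adjoint C = C"
    using B by (intro eq_matI) (auto simp: C_def intro!: herm[symmetric])
  ultimately obtain V l where V: "is_unitary n V" "C = unitary_diag n V l"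
    using Suc.IH by blast
  note Vd = is_unitaryD[OF V(1)]
  define E where "E = mat ?N ?N
    (\<lambda>(i, j). if i = 0 \<or> j = 0 then (if i = j then 1 else 0) else V $$ (i - 1, j - 1))"
  define l' where "l' k = (if k = 0 then Re e else l (k - 1))" for k
  have E: "is_unitary ?N E" unfolding E_def by (rule is_unitary_extend[OF V(1)])
  note Ed = is_unitaryD[OF E]
  have "B = unitary_diag ?N E l'"
  proof (rule eq_matI)
    fix i j assume "i < dim_row (unitary_diag ?N E l')" "j < dim_col (unitary_diag ?N E l')"
    then have ij: "i < ?N" "j < ?N" using carrier_matD[OF unitary_diag_carrier[OF Ed(1)]] by auto
    have s: "unitary_diag ?N E l' $$ (i, j) = E $$ (i, 0) * of_real (l' 0) * cnj (E $$ (j, 0))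
        + (\<Sum>k<n. E $$ (i, Suc k) * of_real (l' (Suc k)) * cnj (E $$ (j, Suc k)))"
      using ij by (simp only: unitary_diag_index[OF Ed(1)] sum.lessThan_Suc_shift)
    show "B $$ (i, j) = unitary_diag ?N E l' $$ (i, j)"
    proof (cases "i = 0 \<or> j = 0")
      case True
      then show ?thesis using ij B0 Brow Bdiag unfolding s
        by (cases "i = 0"; cases "j = 0") (auto simp: E_def l'_def)
    next
      case False
      then have ij': "i - 1 < n" "j - 1 < n" using ij by auto
      have "B $$ (i, j) = C $$ (i - 1, j - 1)" using False ij' by (simp add: C_def)
      also have "\<dots> = (\<Sum>k<n. V $$ (i - 1, k) * of_real (l k) * cnj (V $$ (j - 1, k)))"
        unfolding V(2) by (rule unitary_diag_index[OF Vd(1) ij'])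
      finally show ?thesis using False ij unfolding s by (simp add: E_def l'_def)
    qed
  qed (use B carrier_matD[OF unitary_diag_carrier[OF Ed(1)]] in auto)
  then have "A = unitary_diag ?N (W * E) l'"
    using AB conj_unitary_diag[OF Wd(1) Ed(1)] by simp
  then show ?case using is_unitary_mult[OF W(1) E] by blast
qed

section \<open>Entropy and trace norm in terms of eigenvalues\<close>

lemma unitary_diag_eigenvalue_sum_unique:
  assumes U: "is_unitary d U" and V: "is_unitary d V"
    and eq: "unitary_diag d U l = unitary_diag d V m"
  shows "(\<Sum>i<d. g (l i)) = (\<Sum>i<d. g (m i) :: real)"
proof -
  note Ud = is_unitaryD[OF U] and Vd = is_unitaryD[OF V]
  let ?D = "\<lambda>l. mat_diag d (\<lambda>i. complex_of_real (l i))"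
  have D: "?D l \<in> carrier_mat d d" for l by simp
  define W where "W = mat_adjoint V * U"
  have W: "is_unitary d W" unfolding W_def by (intro is_unitary_mult is_unitary_adjoint U V)
  note Wd = is_unitaryD[OF W]
  have "W * ?D l = mat_adjoint V * unitary_diag d U l * U"
    unfolding W_def unitary_diag_def using Ud(1,2) Vd(1) D
    by (simp add: assoc_mult_mat[of _ d d _ d _ d] right_mult_one_mat[of _ d d])
  also have "\<dots> = (mat_adjoint V * V) * ?D m * W"
    unfolding eq unfolding W_def unitary_diag_def using Ud(1) Vd(1) D
    by (simp add: assoc_mult_mat[of _ d d _ d _ d])
  also have "\<dots> = ?D m * W" using Vd(2) Wd(1) D by (simp add: left_mult_one_mat[of _ d d])
  finally have WD: "W * ?D l = ?D m * W" .
  \<comment> \<open>An entry of the intertwiner can only be nonzero where the two eigenvalues agree.\<close>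
  have ent: "(cmod (W $$ (i, j)))\<^sup>2 * g (l j) = (cmod (W $$ (i, j)))\<^sup>2 * g (m i)"
    if "i < d" "j < d" for i j
  proof -
    have "W $$ (i, j) * of_real (l j) = of_real (m i) * W $$ (i, j)"
      using arg_cong[OF WD, of "\<lambda>M. M $$ (i, j)"] that Wd(1)
      by (simp add: mat_diag_mult_right[of _ d] mat_diag_mult_left[of _ d d])
    then show ?thesis by auto
  qed
  have "(\<Sum>j<d. g (l j)) = (\<Sum>j<d. (\<Sum>i<d. (cmod (W $$ (i, j)))\<^sup>2) * g (l j))"
    using is_unitary_col_norm[OF W] by simp
  also have "\<dots> = (\<Sum>j<d. \<Sum>i<d. (cmod (W $$ (i, j)))\<^sup>2 * g (m i))"
    by (auto simp: sum_distrib_right ent intro!: sum.cong)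
  also have "\<dots> = (\<Sum>i<d. (\<Sum>j<d. (cmod (W $$ (i, j)))\<^sup>2) * g (m i))"
    by (subst sum.swap) (simp add: sum_distrib_right)
  also have "\<dots> = (\<Sum>i<d. g (m i))" using is_unitary_row_norm[OF W] by simp
  finally show ?thesis .
qed

lemma mat_fun_unitary_diag:
  assumes "is_unitary d U"
  obtains V m where "is_unitary d V" "unitary_diag d U l = unitary_diag d V m"
    "mat_fun f (unitary_diag d U l) = unitary_diag d V (\<lambda>i. f (m i))"
proof -
  have [simp]: "dim_row U = d" using is_unitaryD(1)[OF assms] by simp
  have "\<exists>V m. is_unitary d V \<and> unitary_diag d U l = unitary_diag d V m \<and>
      mat_fun f (unitary_diag d U l) = unitary_diag d V (\<lambda>i. f (m i))"
    unfolding mat_fun_def dim_unitary_diag \<open>dim_row U = d\<close> unitary_diag_def[symmetric]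
    by (rule someI_ex) (use assms in blast)
  then show ?thesis using that by blast
qed

definition eta :: "real \<Rightarrow> real" where
  "eta x = - x * log 2 x"

lemma von_neumann_entropy_unitary_diag:
  assumes "is_unitary d U"
  shows "von_neumann_entropy (unitary_diag d U l) = (\<Sum>i<d. eta (l i))"
proof -
  obtain V m where V: "is_unitary d V" "unitary_diag d U l = unitary_diag d V m"
    "mat_fun (log 2) (unitary_diag d U l) = unitary_diag d V (\<lambda>i. log 2 (m i))"
    using mat_fun_unitary_diag[OF assms] .
  have "unitary_diag d U l * mat_fun (log 2) (unitary_diag d U l)
      = unitary_diag d V (\<lambda>i. m i * log 2 (m i))"
    unfolding V(3) unfolding V(2) by (rule unitary_diag_mult[OF V(1)])
  then have "von_neumann_entropy (unitary_diag d U l) = (\<Sum>i<d. eta (m i))"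
    by (simp add: von_neumann_entropy_def mat_trace_unitary_diag[OF V(1)] eta_def sum_negf)
  then show ?thesis using unitary_diag_eigenvalue_sum_unique[OF assms V(1,2)] by simp
qed

lemma trace_norm_unitary_diag:
  assumes "is_unitary d U"
  shows "trace_norm (unitary_diag d U l) = (\<Sum>i<d. \<bar>l i\<bar>)"
proof -
  have sq: "mat_adjoint (unitary_diag d U l) * unitary_diag d U l = unitary_diag d U (\<lambda>i. l i * l i)"
    using is_unitaryD(1)[OF assms]
    by (simp add: mat_adjoint_unitary_diag unitary_diag_mult[OF assms])
  obtain V m where V: "is_unitary d V" "unitary_diag d U (\<lambda>i. l i * l i) = unitary_diag d V m"
    "mat_fun sqrt (unitary_diag d U (\<lambda>i. l i * l i)) = unitary_diag d V (\<lambda>i. sqrt (m i))"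
    using mat_fun_unitary_diag[OF assms] .
  have "trace_norm (unitary_diag d U l) = (\<Sum>i<d. sqrt (m i))"
    by (simp add: trace_norm_def sq V(3) mat_trace_unitary_diag[OF V(1)])
  also have "\<dots> = (\<Sum>i<d. sqrt (l i * l i))"
    by (rule unitary_diag_eigenvalue_sum_unique[OF assms V(1,2), symmetric])
  finally show ?thesis by simp
qed

lemma conj_diagonal_eq_quadratic_form:
  fixes A V :: "complex mat"
  assumes "A \<in> carrier_mat d d" "V \<in> carrier_mat d d" "k < d"
  shows "(mat_adjoint V * A * V) $$ (k, k) = (A *\<^sub>v col V k) \<bullet>c col V k"
proof -
  have "(mat_adjoint V * A * V) $$ (k, k) = (mat_adjoint V * (A * V)) $$ (k, k)"
    using assms by (simp add: assoc_mult_mat[of _ d d _ d _ d])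
  also have "\<dots> = (\<Sum>i<d. mat_adjoint V $$ (k, i) * (A * V) $$ (i, k))"
    using assms by (intro mat_mult_index) auto
  also have "\<dots> = (\<Sum>i<d. (A *\<^sub>v col V k) $ i * cnj (col V k $ i))"
    using assms by (intro sum.cong) (auto simp: mult.commute)
  also have "\<dots> = (A *\<^sub>v col V k) \<bullet>c col V k"
    using assms by (simp add: scalar_prod_def lessThan_atLeast0)
  finally show ?thesis .
qed

lemma positive_semidefinite_unitary_diag:
  assumes U: "is_unitary d U" and l: "\<And>i. i < d \<Longrightarrow> 0 \<le> l i"
  shows "positive_semidefinite (unitary_diag d U l)"
  unfolding positive_semidefinite_def
proof (intro conjI ballI)
  let ?A = "unitary_diag d U l"
  note Ud = is_unitaryD[OF U]
  show "square_mat ?A" "mat_adjoint ?A = ?A" using Ud(1) by (auto simp: mat_adjoint_unitary_diag)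
  fix v :: "complex vec" assume "v \<in> carrier_vec (dim_row ?A)"
  then have v: "v \<in> carrier_vec d" using Ud(1) by simp
  define z where "z k = (\<Sum>j<d. cnj (U $$ (j, k)) * v $ j)" for k
  have "(?A *\<^sub>v v) \<bullet>c v = (\<Sum>i<d. (\<Sum>j<d. ?A $$ (i, j) * v $ j) * cnj (v $ i))"
    using v Ud(1) by (simp add: scalar_prod_def lessThan_atLeast0)
  also have "\<dots> = (\<Sum>i<d. \<Sum>j<d. \<Sum>k<d. of_real (l k) * (cnj (U $$ (j, k)) * v $ j) * (U $$ (i, k) * cnj (v $ i)))"
    using Ud(1)
    by (auto simp: unitary_diag_index sum_distrib_left sum_distrib_right ac_simps intro!: sum.cong)
  also have "\<dots> = (\<Sum>i<d. \<Sum>k<d. of_real (l k) * z k * (U $$ (i, k) * cnj (v $ i)))"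
    unfolding z_def sum_distrib_left sum_distrib_right by (intro sum.cong refl sum.swap)
  also have "\<dots> = (\<Sum>k<d. of_real (l k) * z k * cnj (z k))"
    by (subst sum.swap) (simp add: z_def sum_distrib_left)
  also have "\<dots> = of_real (\<Sum>k<d. l k * (cmod (z k))\<^sup>2)"
    by (simp only: of_real_sum of_real_mult complex_norm_square mult.assoc)
  finally show "0 \<le> Re ((?A *\<^sub>v v) \<bullet>c v)" using l by (auto intro!: sum_nonneg)
qed

lemma is_state_unitary_diagI:
  assumes "is_unitary d U" "\<And>i. i < d \<Longrightarrow> 0 \<le> l i" "(\<Sum>i<d. l i) = 1"
  shows "is_state d (unitary_diag d U l)"
  using assms is_unitaryD(1)[OF assms(1)]
  by (simp add: is_state_def positive_semidefinite_unitary_diag mat_trace_unitary_diag)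

lemma is_state_unitary_diagE:
  assumes "is_state d \<rho>"
  obtains U l where "is_unitary d U" "\<rho> = unitary_diag d U l"
    "\<And>i. i < d \<Longrightarrow> 0 \<le> l i" "(\<Sum>i<d. l i) = 1"
proof -
  have r: "\<rho> \<in> carrier_mat d d" "positive_semidefinite \<rho>" "mat_trace \<rho> = 1"
    using assms by (auto simp: is_state_def)
  then obtain U l where U: "is_unitary d U" "\<rho> = unitary_diag d U l"
    using hermitian_diagonalization[of \<rho> d] by (auto simp: positive_semidefinite_def)
  note Ud = is_unitaryD[OF U(1)]
  have "0 \<le> l i" if i: "i < d" for i
  proof -
    have "mat_adjoint U * \<rho> * U = unitary_diag d (mat_adjoint U * U) l"
      using conj_unitary_diag[of "mat_adjoint U" d U l] Ud(1) U(2) by simp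
    then have "(mat_adjoint U * \<rho> * U) $$ (i, i) = of_real (l i)"
      using i by (simp add: Ud(2) unitary_diag_one) (simp add: mat_diag_def)
    then have "of_real (l i) = (\<rho> *\<^sub>v col U i) \<bullet>c col U i"
      using conj_diagonal_eq_quadratic_form[OF r(1) Ud(1) i] by simp
    moreover have "0 \<le> Re ((\<rho> *\<^sub>v col U i) \<bullet>c col U i)"
      using r Ud(1) i col_carrier_vec[OF i Ud(1)] by (auto simp: positive_semidefinite_def)
    ultimately show ?thesis by (metis Re_complex_of_real)
  qed
  moreover have "(\<Sum>i<d. l i) = 1"
    using r(3) unfolding U(2) mat_trace_unitary_diag[OF U(1)] by (simp only: of_real_eq_1_iff)
  ultimately show ?thesis using that U by blast
qed

section \<open>Concavity of the entropy function\<close>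

lemma eta_0 [simp]: "eta 0 = 0"
  by (simp add: eta_def)

lemma eta_nonneg: "0 \<le> x \<Longrightarrow> x \<le> 1 \<Longrightarrow> 0 \<le> eta x"
  by (cases "x = 0") (auto simp: eta_def mult_nonneg_nonpos)

lemma eta_le_tangent:
  assumes "0 \<le> x" "0 < y"
  shows "eta x \<le> eta y - (log 2 y + 1 / ln 2) * (x - y)"
proof -
  have "x * ln y - x * ln x \<le> y - x"
  proof (cases "x = 0")
    case False
    then have "ln (y / x) \<le> y / x - 1" using assms by (intro ln_le_minus_one) simp
    then have "x * ln (y / x) \<le> x * (y / x - 1)" using assms by (intro mult_left_mono) auto
    moreover have "x * (y / x - 1) = y - x" using False by (simp add: field_simps)
    ultimately show ?thesis using False assms by (simp add: ln_div algebra_simps)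
  qed (use assms in simp)
  then have "(x * ln y - x * ln x) / ln 2 \<le> (y - x) / ln 2" by (intro divide_right_mono) auto
  then show ?thesis
    using assms(2) by (simp add: eta_def log_def diff_divide_distrib add_divide_distrib algebra_simps)
qed

lemma eta_jensen:
  fixes w x :: "'a \<Rightarrow> real"
  assumes "finite A" "\<And>i. i \<in> A \<Longrightarrow> 0 \<le> w i" "(\<Sum>i\<in>A. w i) = 1" "\<And>i. i \<in> A \<Longrightarrow> 0 \<le> x i"
  shows "(\<Sum>i\<in>A. w i * eta (x i)) \<le> eta (\<Sum>i\<in>A. w i * x i)"
proof -
  define y where "y = (\<Sum>i\<in>A. w i * x i)"
  have nn: "0 \<le> w i * x i" if "i \<in> A" for i using assms that by simp
  then have "0 \<le> y" unfolding y_def by (rule sum_nonneg)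
  show ?thesis
  proof (cases "y = 0")
    case True
    then have "w i * x i = 0" if "i \<in> A" for i
      using sum_nonneg_eq_0_iff[of A "\<lambda>i. w i * x i"] assms(1) nn that by (simp add: y_def)
    then have "w i * eta (x i) = 0" if "i \<in> A" for i using that by (auto simp: eta_def)
    then show ?thesis using True by (simp add: y_def)
  next
    case False
    with \<open>0 \<le> y\<close> have y: "0 < y" by simp
    define c where "c = log 2 y + 1 / ln 2"
    have "(\<Sum>i\<in>A. w i * eta (x i)) \<le> (\<Sum>i\<in>A. w i * (eta y - c * (x i - y)))"
      unfolding c_def using assms y by (intro sum_mono mult_left_mono eta_le_tangent) auto
    also have "\<dots> = (\<Sum>i\<in>A. w i * (eta y + c * y) - c * (w i * x i))"
      by (intro sum.cong refl) (simp add: algebra_simps)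
    also have "\<dots> = (\<Sum>i\<in>A. w i) * (eta y + c * y) - c * y"
      by (simp only: sum_subtractf y_def sum_distrib_left sum_distrib_right)
    finally show ?thesis using assms(3) by (simp add: y_def)
  qed
qed

lemma sum_eta_le_marginal:
  assumes "\<And>k. k < b \<Longrightarrow> 0 \<le> q k" "0 < b"
  shows "(\<Sum>k<b. eta (q k)) \<le> eta (\<Sum>k<b. q k) + (\<Sum>k<b. q k) * log 2 (real b)"
proof -
  let ?s = "\<Sum>k<b. q k"
  have s: "0 \<le> ?s" using assms by (intro sum_nonneg) auto
  have "(\<Sum>k<b. 1 / real b * eta (q k)) \<le> eta (\<Sum>k<b. 1 / real b * q k)"
    using assms by (intro eta_jensen) auto
  then have "(\<Sum>k<b. eta (q k)) / real b \<le> eta (?s / real b)"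
    by (simp add: sum_divide_distrib)
  then have "(\<Sum>k<b. eta (q k)) \<le> real b * eta (?s / real b)"
    using assms by (simp add: field_simps)
  also have "\<dots> = eta ?s + ?s * log 2 (real b)"
    using assms s by (cases "?s = 0") (auto simp: eta_def log_divide field_simps)
  finally show ?thesis .
qed

lemma sum_eta_le_log:
  assumes "\<And>k. k < b \<Longrightarrow> 0 \<le> q k" "(\<Sum>k<b. q k) = 1"
  shows "(\<Sum>k<b. eta (q k)) \<le> log 2 (real b)"
proof -
  have "0 < b" using assms(2) by (cases b) auto
  then show ?thesis using sum_eta_le_marginal[of b q] assms by (simp add: eta_def[of 1])
qed

lemma sum_eta_le_diagonal:
  assumes W: "is_unitary d W" and l: "\<And>i. i < d \<Longrightarrow> 0 \<le> l i"
  shows "(\<Sum>i<d. eta (l i)) \<le> (\<Sum>i<d. eta (Re (unitary_diag d W l $$ (i, i))))"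
proof -
  note Wd = is_unitaryD[OF W]
  have "(\<Sum>i<d. eta (l i)) = (\<Sum>k<d. (\<Sum>i<d. (cmod (W $$ (i, k)))\<^sup>2) * eta (l k))"
    using is_unitary_col_norm[OF W] by simp
  also have "\<dots> = (\<Sum>i<d. \<Sum>k<d. (cmod (W $$ (i, k)))\<^sup>2 * eta (l k))"
    by (subst sum.swap) (simp add: sum_distrib_right)
  also have "\<dots> \<le> (\<Sum>i<d. eta (\<Sum>k<d. (cmod (W $$ (i, k)))\<^sup>2 * l k))"
    using is_unitary_row_norm[OF W] l by (intro sum_mono eta_jensen) auto
  finally show ?thesis using Wd(1) by (simp add: unitary_diag_diagonal)
qed

lemma sum_abs_diagonal_le:
  assumes W: "is_unitary d W"
  shows "(\<Sum>i<d. \<bar>Re (unitary_diag d W l $$ (i, i))\<bar>) \<le> (\<Sum>i<d. \<bar>l i\<bar>)"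
proof -
  note Wd = is_unitaryD[OF W]
  have "(\<Sum>i<d. \<bar>Re (unitary_diag d W l $$ (i, i))\<bar>)
      = (\<Sum>i<d. \<bar>\<Sum>k<d. (cmod (W $$ (i, k)))\<^sup>2 * l k\<bar>)"
    using Wd(1) by (simp add: unitary_diag_diagonal)
  also have "\<dots> \<le> (\<Sum>i<d. \<Sum>k<d. (cmod (W $$ (i, k)))\<^sup>2 * \<bar>l k\<bar>)"
    by (intro sum_mono order_trans[OF sum_abs]) (simp add: abs_mult)
  also have "\<dots> = (\<Sum>k<d. (\<Sum>i<d. (cmod (W $$ (i, k)))\<^sup>2) * \<bar>l k\<bar>)"
    by (subst sum.swap) (simp add: sum_distrib_right)
  also have "\<dots> = (\<Sum>i<d. \<bar>l i\<bar>)" using is_unitary_col_norm[OF W] by simp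
  finally show ?thesis .
qed

section \<open>Tensor products and partial traces\<close>

lemma pair_index_less: "i < a \<Longrightarrow> k < b \<Longrightarrow> i * b + k < a * (b :: nat)"
proof -
  assume "i < a" "k < b"
  then have "i * b + k < Suc i * b" by simp
  also have "\<dots> \<le> a * b" using \<open>i < a\<close> by (intro mult_le_mono1) simp
  finally show ?thesis .
qed

lemma pair_index_cases:
  assumes "x < a * (b :: nat)"
  obtains i k where "i < a" "k < b" "x = i * b + k"
proof (rule that[of "x div b" "x mod b"])
  have "b \<noteq> 0" using assms by (cases b) auto
  then show "x mod b < b" by simp
qed (use assms in \<open>auto intro: less_mult_imp_div_less\<close>)

lemma sum_pair_index:
  fixes g :: "nat \<Rightarrow> 'a :: comm_monoid_add"
  shows "(\<Sum>x<a * b. g x) = (\<Sum>i<a. \<Sum>k<b. g (i * b + k))"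
proof -
  have "(\<Sum>x<a * b. g x) = (\<Sum>i<a. \<Sum>x\<in>{i * b..<i * b + b}. g x)"
    by (simp add: sum.nat_group)
  moreover have "sum g {i * b..<i * b + b} = (\<Sum>k<b. g (i * b + k))" for i
    using sum.shift_bounds_nat_ivl[of g 0 "i * b" b] by (simp add: lessThan_atLeast0 add.commute)
  ultimately show ?thesis by simp
qed

lemma tensor_carrier [simp]:
  "A \<in> carrier_mat a a \<Longrightarrow> B \<in> carrier_mat b b \<Longrightarrow> tensor A B \<in> carrier_mat (a * b) (a * b)"
  by (auto simp: tensor_def)

lemma dim_tensor [simp]:
  "dim_row (tensor A B) = dim_row A * dim_row B" "dim_col (tensor A B) = dim_col A * dim_col B"
  by (auto simp: tensor_def)

lemma tensor_index [simp]:
  assumes "A \<in> carrier_mat a a" "B \<in> carrier_mat b b" "i < a" "k < b" "j < a" "l < b"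
  shows "tensor A B $$ (i * b + k, j * b + l) = A $$ (i, j) * B $$ (k, l)"
  using assms by (auto simp: tensor_def pair_index_less)

lemma eq_mat_pair_indexI:
  assumes "A \<in> carrier_mat (a * b) (a * b)" "B \<in> carrier_mat (a * b) (a * b)"
    and "\<And>i k j l. i < a \<Longrightarrow> k < b \<Longrightarrow> j < a \<Longrightarrow> l < b \<Longrightarrow>
      A $$ (i * b + k, j * b + l) = B $$ (i * b + k, j * b + l)"
  shows "A = B"
proof (rule eq_matI)
  fix x y assume "x < dim_row B" "y < dim_col B"
  then have "x < a * b" "y < a * b" using assms by auto
  then show "A $$ (x, y) = B $$ (x, y)" by (metis assms(3) pair_index_cases)
qed (use assms in auto)

lemma tensor_mult:
  fixes A B C D :: "complex mat"
  assumes "A \<in> carrier_mat a a" "B \<in> carrier_mat a a" "C \<in> carrier_mat b b" "D \<in> carrier_mat b b"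
  shows "tensor A C * tensor B D = tensor (A * B) (C * D)"
proof (rule eq_mat_pair_indexI[where a = a and b = b])
  fix i k j l assume ik: "i < a" "k < b" "j < a" "l < b"
  have "(tensor A C * tensor B D) $$ (i * b + k, j * b + l)
      = (\<Sum>x<a * b. tensor A C $$ (i * b + k, x) * tensor B D $$ (x, j * b + l))"
    using assms ik pair_index_less by (intro mat_mult_index[of _ "a * b"]) auto
  also have "\<dots> = (\<Sum>i'<a. \<Sum>k'<b. (A $$ (i, i') * B $$ (i', j)) * (C $$ (k, k') * D $$ (k', l)))"
    unfolding sum_pair_index using assms ik by (intro sum.cong refl) simp
  also have "\<dots> = (\<Sum>i'<a. A $$ (i, i') * B $$ (i', j)) * (\<Sum>k'<b. C $$ (k, k') * D $$ (k', l))"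
    by (simp add: sum_product)
  also have "\<dots> = (A * B) $$ (i, j) * (C * D) $$ (k, l)"
    using assms ik by (simp only: mat_mult_index[of _ a a] mat_mult_index[of _ b b])
  finally show "(tensor A C * tensor B D) $$ (i * b + k, j * b + l)
      = tensor (A * B) (C * D) $$ (i * b + k, j * b + l)"
    using tensor_index[of "A * B" a "C * D" b] assms ik by (simp del: index_mult_mat)
qed (use assms in simp_all)

lemma mat_adjoint_tensor:
  assumes "A \<in> carrier_mat a a" "B \<in> carrier_mat b b"
  shows "mat_adjoint (tensor A B) = tensor (mat_adjoint A) (mat_adjoint B)"
proof (rule eq_mat_pair_indexI[where a = a and b = b])
  fix i k j l assume ik: "i < a" "k < b" "j < a" "l < b"
  then show "mat_adjoint (tensor A B) $$ (i * b + k, j * b + l)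
      = tensor (mat_adjoint A) (mat_adjoint B) $$ (i * b + k, j * b + l)"
    using assms pair_index_less[of i a k b] pair_index_less[of j a l b]
      tensor_index[of "mat_adjoint A" a "mat_adjoint B" b i k j l] tensor_index[of A a B b j l i k]
    by (auto simp del: tensor_index)
qed (use assms in simp_all)

lemma tensor_mat_diag:
  "tensor (mat_diag a f) (mat_diag b g) = mat_diag (a * b) (\<lambda>x. f (x div b) * g (x mod b))"
proof (rule eq_mat_pair_indexI[where a = a and b = b])
  fix i k j l assume ik: "i < a" "k < b" "j < a" "l < b"
  have "i = j \<and> k = l" if eq: "i * b + k = j * b + l"
  proof
    show "i = j" using arg_cong[OF eq, of "\<lambda>x. x div b"] ik by simp
    show "k = l" using arg_cong[OF eq, of "\<lambda>x. x mod b"] ik by simp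
  qed
  then show "tensor (mat_diag a f) (mat_diag b g) $$ (i * b + k, j * b + l)
      = mat_diag (a * b) (\<lambda>x. f (x div b) * g (x mod b)) $$ (i * b + k, j * b + l)"
    using ik pair_index_less[of i a k b] pair_index_less[of j a l b]
    unfolding tensor_index[OF mat_diag_dim mat_diag_dim ik] by (auto simp: mat_diag_def)
qed simp_all

lemma tensor_one: "tensor (1\<^sub>m a) (1\<^sub>m b) = 1\<^sub>m (a * b)"
  using tensor_mat_diag[of a "\<lambda>_. 1" b "\<lambda>_. 1"] by simp

lemma is_unitary_tensor:
  assumes "is_unitary a U" "is_unitary b V"
  shows "is_unitary (a * b) (tensor U V)"
proof (rule is_unitaryI)
  note U = is_unitaryD[OF assms(1)] and V = is_unitaryD[OF assms(2)]
  show "tensor U V \<in> carrier_mat (a * b) (a * b)" using U V by simp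
  show "mat_adjoint (tensor U V) * tensor U V = 1\<^sub>m (a * b)"
    using U V by (simp add: mat_adjoint_tensor tensor_mult[of _ a _ _ b] tensor_one)
qed

lemma tensor_unitary_diag:
  assumes "U \<in> carrier_mat a a" "V \<in> carrier_mat b b"
  shows "tensor (unitary_diag a U l) (unitary_diag b V m)
    = unitary_diag (a * b) (tensor U V) (\<lambda>x. l (x div b) * m (x mod b))"
proof -
  let ?D = "\<lambda>d l. mat_diag d (\<lambda>i. complex_of_real (l i))"
  have D: "?D d l \<in> carrier_mat d d" for d l by simp
  have "tensor (unitary_diag a U l) (unitary_diag b V m)
      = tensor U V * tensor (?D a l) (?D b m) * tensor (mat_adjoint U) (mat_adjoint V)"
    unfolding unitary_diag_def using assms D
    by (simp only: tensor_mult[of _ a _ _ b] mult_square_carrier mat_adjoint_carrier)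
  then show ?thesis
    unfolding unitary_diag_def using assms by (simp add: mat_adjoint_tensor tensor_mat_diag)
qed

lemma maximally_mixed_eq: "maximally_mixed K = unitary_diag K (1\<^sub>m K) (\<lambda>_. 1 / real K)"
  unfolding unitary_diag_one maximally_mixed_def by (rule eq_matI) (auto simp: mat_diag_def)

lemma tensor_maximally_mixed:
  assumes "U \<in> carrier_mat d d"
  shows "tensor (unitary_diag d U l) (maximally_mixed K)
    = unitary_diag (d * K) (tensor U (1\<^sub>m K)) (\<lambda>x. l (x div K) / real K)"
  unfolding maximally_mixed_eq using tensor_unitary_diag[OF assms, of "1\<^sub>m K" K] by simp

lemma partial_trace_carrier [simp]: "partial_trace a b \<rho> \<in> carrier_mat a a"
  by (simp add: partial_trace_def)

lemma tensor_one_mult_index: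
  fixes W R :: "complex mat"
  assumes "W \<in> carrier_mat a a" "R \<in> carrier_mat (a * b) (a * b)" "i < a" "k < b" "y < a * b"
  shows "(tensor W (1\<^sub>m b) * R) $$ (i * b + k, y) = (\<Sum>j<a. W $$ (i, j) * R $$ (j * b + k, y))"
proof -
  have "(tensor W (1\<^sub>m b) * R) $$ (i * b + k, y)
      = (\<Sum>x<a * b. tensor W (1\<^sub>m b) $$ (i * b + k, x) * R $$ (x, y))"
    using assms pair_index_less by (intro mat_mult_index[of _ "a * b"]) auto
  also have "\<dots> = (\<Sum>j<a. \<Sum>l<b. if l = k then W $$ (i, j) * R $$ (j * b + l, y) else 0)"
    unfolding sum_pair_index using assms by (intro sum.cong refl) (auto simp: tensor_index[of _ a _ b])
  finally show ?thesis using assms by simp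
qed

lemma mult_tensor_one_index:
  fixes W R :: "complex mat"
  assumes "W \<in> carrier_mat a a" "R \<in> carrier_mat (a * b) (a * b)" "i < a" "k < b" "y < a * b"
  shows "(R * tensor W (1\<^sub>m b)) $$ (y, i * b + k) = (\<Sum>j<a. R $$ (y, j * b + k) * W $$ (j, i))"
proof -
  have "(R * tensor W (1\<^sub>m b)) $$ (y, i * b + k)
      = (\<Sum>x<a * b. R $$ (y, x) * tensor W (1\<^sub>m b) $$ (x, i * b + k))"
    using assms pair_index_less by (intro mat_mult_index[of _ "a * b"]) auto
  also have "\<dots> = (\<Sum>j<a. \<Sum>l<b. if l = k then R $$ (y, j * b + l) * W $$ (j, i) else 0)"
    unfolding sum_pair_index using assms by (intro sum.cong refl) (auto simp: tensor_index[of _ a _ b])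
  finally show ?thesis using assms by simp
qed

lemma partial_trace_conj_local:
  fixes W R :: "complex mat"
  assumes W: "W \<in> carrier_mat a a" and R: "R \<in> carrier_mat (a * b) (a * b)"
  shows "partial_trace a b (tensor W (1\<^sub>m b) * R * mat_adjoint (tensor W (1\<^sub>m b)))
    = W * partial_trace a b R * mat_adjoint W"
proof (rule eq_matI)
  let ?W = "tensor W (1\<^sub>m b)" and ?P = "partial_trace a b R"
  fix i j assume "i < dim_row (W * ?P * mat_adjoint W)" "j < dim_col (W * ?P * mat_adjoint W)"
  then have ij: "i < a" "j < a" using W by auto
  have adj: "mat_adjoint ?W = tensor (mat_adjoint W) (1\<^sub>m b)"
    using W by (simp add: mat_adjoint_tensor[of _ a _ b])
  have WR: "?W * R \<in> carrier_mat (a * b) (a * b)" using W R by simp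
  have "partial_trace a b (?W * R * mat_adjoint ?W) $$ (i, j)
      = (\<Sum>k<b. (?W * R * tensor (mat_adjoint W) (1\<^sub>m b)) $$ (i * b + k, j * b + k))"
    using ij by (simp add: partial_trace_def adj)
  also have "\<dots> = (\<Sum>k<b. \<Sum>j'<a. (\<Sum>i'<a. W $$ (i, i') * R $$ (i' * b + k, j' * b + k)) * mat_adjoint W $$ (j', j))"
  proof (intro sum.cong refl)
    fix k assume "k \<in> {..<b}"
    then have k: "k < b" by simp
    have "(?W * R) $$ (i * b + k, j' * b + k) = (\<Sum>i'<a. W $$ (i, i') * R $$ (i' * b + k, j' * b + k))"
      if "j' < a" for j'
      by (rule tensor_one_mult_index[OF W R ij(1) k pair_index_less[OF that k]])
    then show "(?W * R * tensor (mat_adjoint W) (1\<^sub>m b)) $$ (i * b + k, j * b + k)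
      = (\<Sum>j'<a. (\<Sum>i'<a. W $$ (i, i') * R $$ (i' * b + k, j' * b + k)) * mat_adjoint W $$ (j', j))"
      unfolding mult_tensor_one_index[OF mat_adjoint_carrier[OF W] WR ij(2) k pair_index_less[OF ij(1) k]]
      by (intro sum.cong refl) simp
  qed
  also have "\<dots> = (\<Sum>j'<a. \<Sum>k<b. (\<Sum>i'<a. W $$ (i, i') * R $$ (i' * b + k, j' * b + k)) * mat_adjoint W $$ (j', j))"
    by (rule sum.swap)
  also have "\<dots> = (\<Sum>j'<a. (\<Sum>i'<a. W $$ (i, i') * (\<Sum>k<b. R $$ (i' * b + k, j' * b + k))) * mat_adjoint W $$ (j', j))"
    unfolding sum_distrib_right sum_distrib_left by (intro sum.cong refl sum.swap)
  also have "\<dots> = (\<Sum>j'<a. (W * ?P) $$ (i, j') * mat_adjoint W $$ (j', j))"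
  proof (intro sum.cong refl)
    fix j' assume "j' \<in> {..<a}"
    then have "(W * ?P) $$ (i, j') = (\<Sum>i'<a. W $$ (i, i') * ?P $$ (i', j'))"
      using W ij by (intro mat_mult_index) auto
    also have "\<dots> = (\<Sum>i'<a. W $$ (i, i') * (\<Sum>k<b. R $$ (i' * b + k, j' * b + k)))"
      using \<open>j' \<in> {..<a}\<close> by (intro sum.cong refl) (simp add: partial_trace_def)
    finally show "(\<Sum>i'<a. W $$ (i, i') * (\<Sum>k<b. R $$ (i' * b + k, j' * b + k))) * mat_adjoint W $$ (j', j)
        = (W * ?P) $$ (i, j') * mat_adjoint W $$ (j', j)" by simp
  qed
  also have "\<dots> = (W * ?P * mat_adjoint W) $$ (i, j)"
    using W ij by (intro mat_mult_index[symmetric]) auto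
  finally show "partial_trace a b (?W * R * mat_adjoint ?W) $$ (i, j)
      = (W * ?P * mat_adjoint W) $$ (i, j)" .
qed (use W in \<open>auto simp: partial_trace_def\<close>)

lemma mat_adjoint_partial_trace:
  assumes "R \<in> carrier_mat (a * b) (a * b)" "mat_adjoint R = R"
  shows "mat_adjoint (partial_trace a b R) = partial_trace a b R"
proof (rule eq_matI)
  fix i j assume "i < dim_row (partial_trace a b R)" "j < dim_col (partial_trace a b R)"
  then have ij: "i < a" "j < a" by (auto simp: partial_trace_def)
  have "cnj (R $$ (j * b + k, i * b + k)) = R $$ (i * b + k, j * b + k)" if "k < b" for k
    using mat_adjoint_index[of "i * b + k" R "j * b + k"] assms ij that pair_index_less by simp
  then show "mat_adjoint (partial_trace a b R) $$ (i, j) = partial_trace a b R $$ (i, j)"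
    using ij by (simp add: partial_trace_def)
qed (auto simp: partial_trace_def)

text \<open>The eigenvalues of a reduced state are marginals of the diagonal of the full state,
  taken in a product basis that extends the eigenbasis of the reduced state.\<close>

lemma partial_trace_unitary_diag:
  assumes U: "is_unitary (a * b) U"
  shows "\<exists>W T c. is_unitary a W \<and> is_unitary (a * b) T \<and>
    partial_trace a b (unitary_diag (a * b) U l) = unitary_diag a W c \<and>
    (\<forall>i<a. c i = (\<Sum>k<b. Re (unitary_diag (a * b) T l $$ (i * b + k, i * b + k))))"
proof -
  let ?R = "unitary_diag (a * b) U l" and ?d = "a * b"
  note Ud = is_unitaryD[OF U]
  obtain W c where W: "is_unitary a W" "partial_trace a b ?R = unitary_diag a W c"
    using hermitian_diagonalization[OF partial_trace_carrier mat_adjoint_partial_trace] Ud(1)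
    by (metis mat_adjoint_unitary_diag unitary_diag_carrier)
  note Wd = is_unitaryD[OF W(1)]
  define T where "T = tensor (mat_adjoint W) (1\<^sub>m b) * U"
  have T: "is_unitary ?d T"
    unfolding T_def by (intro is_unitary_mult is_unitary_tensor is_unitary_adjoint W U is_unitary_one)
  have "mat_adjoint W * unitary_diag a W c * W = mat_diag a (\<lambda>i. complex_of_real (c i))"
    using conj_unitary_diag[of "mat_adjoint W" a W c] Wd by (simp add: unitary_diag_one)
  moreover have "mat_adjoint W * unitary_diag a W c * W
      = partial_trace a b (unitary_diag ?d T l)"
    using partial_trace_conj_local[of "mat_adjoint W" a ?R b]
      conj_unitary_diag[of "tensor (mat_adjoint W) (1\<^sub>m b)" ?d U l] Wd(1) Ud(1) W(2)
    by (simp add: T_def)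
  ultimately have eq: "mat_diag a (\<lambda>i. complex_of_real (c i)) = partial_trace a b (unitary_diag ?d T l)"
    by simp
  have "c i = (\<Sum>k<b. Re (unitary_diag ?d T l $$ (i * b + k, i * b + k)))" if "i < a" for i
  proof -
    have "complex_of_real (c i) = (\<Sum>k<b. unitary_diag ?d T l $$ (i * b + k, i * b + k))"
      using arg_cong[OF eq, of "\<lambda>M. M $$ (i, i)"] that by (simp add: mat_diag_def partial_trace_def)
    from arg_cong[OF this, of Re] show ?thesis by simp
  qed
  then show ?thesis using W T by blast
qed

lemma diagonal_unitary_diag_nonneg:
  assumes "is_unitary d W" "\<And>i. i < d \<Longrightarrow> 0 \<le> l i" "i < d"
  shows "0 \<le> Re (unitary_diag d W l $$ (i, i))"
  using assms is_unitaryD(1)[OF assms(1)] by (auto simp: unitary_diag_diagonal intro!: sum_nonneg)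

lemma sum_diagonal_unitary_diag:
  assumes "is_unitary d W"
  shows "(\<Sum>i<d. Re (unitary_diag d W l $$ (i, i))) = (\<Sum>i<d. l i)"
  using arg_cong[OF mat_trace_unitary_diag[OF assms, of l], of Re] is_unitaryD(1)[OF assms]
  by (simp add: mat_trace_def)

section \<open>Monotonicity of the information\<close>

lemma information_unitary_diag:
  assumes "is_unitary d U"
  shows "information (unitary_diag d U l) = log 2 (real d) - (\<Sum>i<d. eta (l i))"
  using is_unitaryD(1)[OF assms]
  by (simp add: information_def von_neumann_entropy_unitary_diag[OF assms])

lemma is_state_dim_pos: "is_state d \<rho> \<Longrightarrow> 0 < d"
  by (erule is_state_unitary_diagE) (cases d; simp)

lemma is_state_conj_unitary:
  assumes "is_unitary d U" "is_state d \<rho>"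
  shows "is_state d (U * \<rho> * mat_adjoint U)"
  using assms(2)
proof (rule is_state_unitary_diagE)
  fix V l assume V: "is_unitary d V" "\<rho> = unitary_diag d V l" "\<And>i. i < d \<Longrightarrow> 0 \<le> l i" "(\<Sum>i<d. l i) = 1"
  then show ?thesis
    using conj_unitary_diag[OF is_unitaryD(1)[OF assms(1)] is_unitaryD(1)[OF V(1)]]
    by (auto intro!: is_state_unitary_diagI is_unitary_mult assms)
qed

lemma information_conj_unitary:
  assumes "is_unitary d U" "is_state d \<rho>"
  shows "information (U * \<rho> * mat_adjoint U) = information \<rho>"
  using assms(2)
proof (rule is_state_unitary_diagE)
  fix V l assume V: "is_unitary d V" "\<rho> = unitary_diag d V l"
  then show ?thesis
    using conj_unitary_diag[OF is_unitaryD(1)[OF assms(1)] is_unitaryD(1)[OF V(1)]]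
    by (simp add: information_unitary_diag is_unitary_mult assms(1))
qed

lemma ancilla_state_information:
  assumes K: "K \<ge> 1" and \<rho>: "is_state d \<rho>"
  shows "is_state (d * K) (tensor \<rho> (maximally_mixed K))"
    and "information (tensor \<rho> (maximally_mixed K)) = information \<rho>"
proof -
  obtain U l where U: "is_unitary d U" "\<rho> = unitary_diag d U l" "\<And>i. i < d \<Longrightarrow> 0 \<le> l i" "(\<Sum>i<d. l i) = 1"
    using is_state_unitary_diagE[OF \<rho>] by blast
  have d: "0 < d" using is_state_dim_pos[OF \<rho>] .
  let ?m = "\<lambda>x. l (x div K) / real K"
  have eq: "tensor \<rho> (maximally_mixed K) = unitary_diag (d * K) (tensor U (1\<^sub>m K)) ?m"
    unfolding U(2) using is_unitaryD(1)[OF U(1)] by (rule tensor_maximally_mixed)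
  have T: "is_unitary (d * K) (tensor U (1\<^sub>m K))" by (intro is_unitary_tensor U is_unitary_one)
  show "is_state (d * K) (tensor \<rho> (maximally_mixed K))"
    unfolding eq using U(3,4) K
    by (intro is_state_unitary_diagI T) (auto simp: sum_pair_index less_mult_imp_div_less)
  have "(\<Sum>x<d * K. eta (?m x)) = (\<Sum>i<d. real K * eta (l i / real K))"
    using K by (simp add: sum_pair_index)
  also have "\<dots> = (\<Sum>i<d. eta (l i) + l i * log 2 (real K))"
  proof (intro sum.cong refl)
    fix i assume "i \<in> {..<d}"
    then show "real K * eta (l i / real K) = eta (l i) + l i * log 2 (real K)"
      using U(3)[of i] K by (cases "l i = 0") (auto simp: eta_def log_divide field_simps)
  qed
  also have "\<dots> = (\<Sum>i<d. eta (l i)) + log 2 (real K)"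
    by (simp add: sum.distrib U(4) sum_distrib_right[symmetric])
  finally have "(\<Sum>x<d * K. eta (?m x)) = (\<Sum>i<d. eta (l i)) + log 2 (real K)" .
  then show "information (tensor \<rho> (maximally_mixed K)) = information \<rho>"
    unfolding eq information_unitary_diag[OF T] unfolding U(2) information_unitary_diag[OF U(1)]
    using K d by (simp add: log_mult)
qed

lemma partial_trace_state_information:
  assumes "is_state (a * b) \<rho>"
  shows "is_state a (partial_trace a b \<rho>)"
    and "information (partial_trace a b \<rho>) \<le> information \<rho>"
proof -
  let ?d = "a * b"
  obtain U l where U: "is_unitary ?d U" "\<rho> = unitary_diag ?d U l"
    "\<And>i. i < ?d \<Longrightarrow> 0 \<le> l i" "(\<Sum>i<?d. l i) = 1"
    using is_state_unitary_diagE[OF assms] by blast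
  have "0 < ?d" using is_state_dim_pos[OF assms] .
  then have ab: "0 < a" "0 < b" by auto
  obtain W T c where W: "is_unitary a W" and T: "is_unitary ?d T"
    and pt: "partial_trace a b \<rho> = unitary_diag a W c"
    and c: "\<forall>i<a. c i = (\<Sum>k<b. Re (unitary_diag ?d T l $$ (i * b + k, i * b + k)))"
    using partial_trace_unitary_diag[OF U(1), of l] unfolding U(2) by blast
  define q where "q x = Re (unitary_diag ?d T l $$ (x, x))" for x
  have q: "0 \<le> q x" if "x < ?d" for x
    unfolding q_def using T U(3) that by (rule diagonal_unitary_diag_nonneg)
  have c: "c i = (\<Sum>k<b. q (i * b + k))" if "i < a" for i using c that by (simp add: q_def)
  have qn: "0 \<le> q (i * b + k)" if "i < a" "k < b" for i k using that by (intro q pair_index_less)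
  have sc: "(\<Sum>i<a. c i) = 1"
    using sum_diagonal_unitary_diag[OF T, of l] U(4) by (simp add: c q_def[symmetric] sum_pair_index)
  show "is_state a (partial_trace a b \<rho>)"
    unfolding pt by (intro is_state_unitary_diagI W sc) (auto simp: c qn intro!: sum_nonneg)
  have "(\<Sum>x<?d. eta (l x)) \<le> (\<Sum>x<?d. eta (q x))"
    unfolding q_def by (rule sum_eta_le_diagonal[OF T U(3)])
  also have "\<dots> = (\<Sum>i<a. \<Sum>k<b. eta (q (i * b + k)))" by (rule sum_pair_index)
  also have "\<dots> \<le> (\<Sum>i<a. eta (c i) + c i * log 2 (real b))"
    using qn ab by (intro sum_mono) (auto simp: c intro!: sum_eta_le_marginal)
  also have "\<dots> = (\<Sum>i<a. eta (c i)) + log 2 (real b)"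
    by (simp add: sum.distrib sc sum_distrib_right[symmetric])
  finally have "(\<Sum>x<?d. eta (l x)) \<le> (\<Sum>i<a. eta (c i)) + log 2 (real b)" .
  then show "information (partial_trace a b \<rho>) \<le> information \<rho>"
    unfolding pt unfolding U(2) information_unitary_diag[OF W] information_unitary_diag[OF U(1)]
    using ab by (simp add: log_mult)
qed

lemma noisy_op_state_information:
  assumes "noisy_op d e L" "is_state d \<rho>"
  shows "is_state e (L \<rho>) \<and> information (L \<rho>) \<le> information \<rho>"
  using assms
proof (induction arbitrary: \<rho> rule: noisy_op.induct)
  case (unitary d U)
  then show ?case by (simp add: is_state_conj_unitary information_conj_unitary)
next
  case (ancilla K d)
  then show ?case by (simp add: ancilla_state_information)
next
  case (discard a b V)
  from is_state_conj_unitary[OF this] information_conj_unitary[OF this]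
  show ?case using partial_trace_state_information by metis
next
  case (compose c d L e M)
  then show ?case using order_trans by blast
qed

theorem information_nonincreasing: "nonincreasing_under_NO information"
  unfolding nonincreasing_under_NO_def using noisy_op_state_information by blast

section \<open>Asymptotic continuity of the information\<close>

lemma eta_le_sqrt:
  assumes "0 \<le> x"
  shows "eta x \<le> 2 * sqrt x / ln 2"
proof (cases "x = 0")
  case False
  then have x: "0 < x" using assms by simp
  have "ln (1 / sqrt x) \<le> 1 / sqrt x - 1" using x by (intro ln_le_minus_one) simp
  then have "2 * x * ln (1 / sqrt x) \<le> 2 * x * (1 / sqrt x)"
    using x by (intro mult_left_mono) auto
  moreover have "2 * x * (1 / sqrt x) = 2 * sqrt x" using x real_div_sqrt[of x] by simp
  moreover have "2 * x * ln (1 / sqrt x) = - x * ln x" using x by (simp add: ln_div ln_sqrt)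
  ultimately have "- x * ln x / ln 2 \<le> 2 * sqrt x / ln 2" by (intro divide_right_mono) auto
  then show ?thesis by (simp add: eta_def log_def)
qed simp

lemma eta_add_diff:
  assumes "0 \<le> x" "0 \<le> t" "x + t \<le> 1"
  shows "\<bar>eta (x + t) - eta x\<bar> \<le> eta t + t / ln 2"
proof (cases "x = 0 \<or> t = 0")
  case True
  then show ?thesis using eta_nonneg[of t] assms by auto
next
  case False
  then have x: "0 < x" "0 < t" using assms by auto
  have "x * log 2 x + t * log 2 t \<le> x * log 2 (x + t) + t * log 2 (x + t)"
    using x by (intro add_mono mult_left_mono) auto
  then have "eta (x + t) \<le> eta x + eta t" by (simp add: eta_def algebra_simps)
  moreover have "eta x - eta (x + t) \<le> t / ln 2"
  proof -
    have "eta x \<le> eta (x + t) + (log 2 (x + t) + 1 / ln 2) * t"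
      using eta_le_tangent[of x "x + t"] x by simp
    moreover have "log 2 (x + t) * t \<le> 0" using x assms by (intro mult_nonpos_nonneg) auto
    ultimately show ?thesis by (simp add: algebra_simps)
  qed
  moreover have "0 \<le> eta t" "0 \<le> t / ln 2" using x assms by (auto intro: eta_nonneg)
  ultimately show ?thesis by linarith
qed

lemma eta_diff:
  assumes "0 \<le> x" "x \<le> 1" "0 \<le> y" "y \<le> 1"
  shows "\<bar>eta x - eta y\<bar> \<le> eta \<bar>x - y\<bar> + \<bar>x - y\<bar> / ln 2"
proof (cases "x \<le> y")
  case True
  then show ?thesis using eta_add_diff[of x "y - x"] assms by (simp add: abs_minus_commute)
next
  case False
  then show ?thesis using eta_add_diff[of y "x - y"] assms by simp
qed

lemma state_diff_unitary_diag:
  assumes "is_state d \<rho>" "is_state d \<sigma>"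
  obtains Z t where "is_unitary d Z" "\<rho> - \<sigma> = unitary_diag d Z t"
proof -
  have c: "\<rho> \<in> carrier_mat d d" "\<sigma> \<in> carrier_mat d d" "mat_adjoint \<rho> = \<rho>" "mat_adjoint \<sigma> = \<sigma>"
    using assms by (auto simp: is_state_def positive_semidefinite_def)
  have "mat_adjoint (\<rho> - \<sigma>) = \<rho> - \<sigma>"
  proof (rule eq_matI)
    fix i j assume "i < dim_row (\<rho> - \<sigma>)" "j < dim_col (\<rho> - \<sigma>)"
    then have ij: "i < d" "j < d" using c by auto
    have "cnj (\<rho> $$ (j, i)) = \<rho> $$ (i, j)" "cnj (\<sigma> $$ (j, i)) = \<sigma> $$ (i, j)"
      using mat_adjoint_index[of i \<rho> j] mat_adjoint_index[of i \<sigma> j] ij c by simp_all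
    then show "mat_adjoint (\<rho> - \<sigma>) $$ (i, j) = (\<rho> - \<sigma>) $$ (i, j)"
      using ij c(1,2) by simp
  qed (use c in auto)
  then show ?thesis
    using hermitian_diagonalization[of "\<rho> - \<sigma>" d] c(1,2) that by (metis minus_carrier_mat)
qed

lemma trace_norm_diff_nonneg:
  assumes "is_state d \<rho>" "is_state d \<sigma>"
  shows "0 \<le> trace_norm (\<rho> - \<sigma>)"
  by (rule state_diff_unitary_diag[OF assms]) (simp add: trace_norm_unitary_diag sum_nonneg)

text \<open>Pinching \<open>\<rho>\<close> to the eigenbasis of \<open>\<sigma>\<close> only increases its entropy, and it leaves a
  distribution which is close to the spectrum of \<open>\<sigma>\<close>.\<close>

lemma entropy_diff_le:
  assumes "is_state d \<rho>" "is_state d \<sigma>"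
  defines "\<delta> \<equiv> trace_norm (\<rho> - \<sigma>)"
  shows "von_neumann_entropy \<rho> - von_neumann_entropy \<sigma>
    \<le> \<delta> * log 2 (real d) + (2 * sqrt \<delta> + \<delta>) / ln 2"
proof -
  obtain U l where U: "is_unitary d U" "\<rho> = unitary_diag d U l"
    "\<And>i. i < d \<Longrightarrow> 0 \<le> l i" "(\<Sum>i<d. l i) = 1"
    using is_state_unitary_diagE[OF assms(1)] by blast
  obtain V m where V: "is_unitary d V" "\<sigma> = unitary_diag d V m"
    "\<And>i. i < d \<Longrightarrow> 0 \<le> m i" "(\<Sum>i<d. m i) = 1"
    using is_state_unitary_diagE[OF assms(2)] by blast
  note Ud = is_unitaryD[OF U(1)] and Vd = is_unitaryD[OF V(1)]
  have d: "0 < d" using is_state_dim_pos assms(1) by blast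
  obtain Z t where Z: "is_unitary d Z" "\<rho> - \<sigma> = unitary_diag d Z t"
    using state_diff_unitary_diag[OF assms(1,2)] .
  note Zd = is_unitaryD[OF Z(1)]
  have \<delta>: "\<delta> = (\<Sum>i<d. \<bar>t i\<bar>)" unfolding \<delta>_def Z(2) by (rule trace_norm_unitary_diag[OF Z(1)])
  define r where "r i = Re (unitary_diag d (mat_adjoint V * U) l $$ (i, i))" for i
  define s where "s i = Re (unitary_diag d (mat_adjoint V * Z) t $$ (i, i))" for i
  have VU: "is_unitary d (mat_adjoint V * U)" and VZ: "is_unitary d (mat_adjoint V * Z)"
    by (intro is_unitary_mult is_unitary_adjoint U V Z)+
  have "mat_adjoint V * (\<rho> - \<sigma>) * V = mat_adjoint V * \<rho> * V - mat_adjoint V * \<sigma> * V"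
    using Ud(1) Vd(1) unfolding U(2) V(2)
    by (simp add: mult_minus_distrib_mat[of _ d d _ d] minus_mult_distrib_mat[of _ d d _ _ d])
  moreover have "mat_adjoint V * \<rho> * V = unitary_diag d (mat_adjoint V * U) l"
    "mat_adjoint V * \<sigma> * V = mat_diag d (\<lambda>i. complex_of_real (m i))"
    "mat_adjoint V * (\<rho> - \<sigma>) * V = unitary_diag d (mat_adjoint V * Z) t"
    using conj_unitary_diag[of "mat_adjoint V" d] Ud(1) Vd Zd(1) unfolding Z(2) unfolding U(2) V(2)
    by (simp_all add: unitary_diag_one)
  ultimately have eq: "unitary_diag d (mat_adjoint V * Z) t
      = unitary_diag d (mat_adjoint V * U) l - mat_diag d (\<lambda>i. complex_of_real (m i))"
    by simp
  have s: "s i = r i - m i" if "i < d" for i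
    using that Ud(1) Vd(1) unfolding s_def eq r_def by (simp add: mat_diag_def)
  have r: "0 \<le> r i" if "i < d" for i
    unfolding r_def using VU U(3) that by (rule diagonal_unitary_diag_nonneg)
  have rs: "(\<Sum>i<d. r i) = 1" unfolding r_def using sum_diagonal_unitary_diag[OF VU] U(4) by simp
  have le1: "r i \<le> 1" "m i \<le> 1" if "i < d" for i
    using member_le_sum[of i "{..<d}" r] member_le_sum[of i "{..<d}" m] that r rs V(3,4) by auto
  let ?s = "\<Sum>i<d. \<bar>s i\<bar>"
  have s\<delta>: "?s \<le> \<delta>" unfolding \<delta> s_def by (rule sum_abs_diagonal_le[OF VZ])
  have s0: "0 \<le> ?s" by (intro sum_nonneg) auto
  have "von_neumann_entropy \<rho> \<le> (\<Sum>i<d. eta (r i))"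
    unfolding U(2) von_neumann_entropy_unitary_diag[OF U(1)] r_def
    by (rule sum_eta_le_diagonal[OF VU U(3)])
  also have "\<dots> \<le> (\<Sum>i<d. eta (m i) + (eta \<bar>s i\<bar> + \<bar>s i\<bar> / ln 2))"
  proof (rule sum_mono)
    fix i assume "i \<in> {..<d}"
    then show "eta (r i) \<le> eta (m i) + (eta \<bar>s i\<bar> + \<bar>s i\<bar> / ln 2)"
      using eta_diff[of "r i" "m i"] r[of i] le1[of i] V(3)[of i] s[of i] by simp
  qed
  also have "\<dots> = von_neumann_entropy \<sigma> + ((\<Sum>i<d. eta \<bar>s i\<bar>) + ?s / ln 2)"
    unfolding V(2) von_neumann_entropy_unitary_diag[OF V(1)]
    by (simp add: sum.distrib sum_divide_distrib)
  also have "(\<Sum>i<d. eta \<bar>s i\<bar>) \<le> eta ?s + ?s * log 2 (real d)"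
    using d by (intro sum_eta_le_marginal) auto
  also have "eta ?s \<le> 2 * sqrt ?s / ln 2" by (rule eta_le_sqrt[OF s0])
  also have "2 * sqrt ?s / ln 2 \<le> 2 * sqrt \<delta> / ln 2"
    using s\<delta> by (intro divide_right_mono mult_left_mono) auto
  also have "?s * log 2 (real d) \<le> \<delta> * log 2 (real d)"
    using s\<delta> d by (intro mult_right_mono) auto
  also have "?s / ln 2 \<le> \<delta> / ln 2" using s\<delta> by (intro divide_right_mono) auto
  finally show ?thesis by (simp add: add_divide_distrib)
qed

lemma trace_norm_diff_commute:
  assumes "is_state d \<rho>" "is_state d \<sigma>"
  shows "trace_norm (\<rho> - \<sigma>) = trace_norm (\<sigma> - \<rho>)"
proof -
  have c: "\<rho> \<in> carrier_mat d d" "\<sigma> \<in> carrier_mat d d" using assms by (auto simp: is_state_def)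
  then have "\<sigma> - \<rho> = - (\<rho> - \<sigma>)" by (intro eq_matI) auto
  moreover have "mat_adjoint (- (\<rho> - \<sigma>)) = - mat_adjoint (\<rho> - \<sigma>)"
    using c by (intro eq_matI) auto
  moreover have "\<rho> - \<sigma> \<in> carrier_mat d d" using c by auto
  ultimately have "mat_adjoint (\<sigma> - \<rho>) * (\<sigma> - \<rho>) = mat_adjoint (\<rho> - \<sigma>) * (\<rho> - \<sigma>)"
    by simp
  then show ?thesis by (simp add: trace_norm_def)
qed

theorem information_asymptotically_continuous: "asymptotically_continuous information"
  unfolding asymptotically_continuous_def
proof (intro allI impI)
  fix d :: "nat \<Rightarrow> nat" and \<rho> \<sigma>
  assume st: "\<forall>n. is_state (d n) (\<rho> n) \<and> is_state (d n) (\<sigma> n)"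
    and d: "filterlim d at_top sequentially"
    and tn: "(\<lambda>n. trace_norm (\<rho> n - \<sigma> n)) \<longlonglongrightarrow> 0"
  let ?\<delta> = "\<lambda>n. trace_norm (\<rho> n - \<sigma> n)"
  let ?B = "\<lambda>n. ?\<delta> n + (2 * sqrt (?\<delta> n) + ?\<delta> n) / ln 2"
  have lim: "?B \<longlonglongrightarrow> 0"
  proof -
    have "?B \<longlonglongrightarrow> 0 + (2 * sqrt 0 + 0) / ln 2" by (intro tendsto_intros tn) simp
    then show ?thesis by simp
  qed
  have ev: "eventually (\<lambda>n. 2 \<le> d n) sequentially" using d by (simp add: filterlim_at_top)
  show "(\<lambda>n. \<bar>information (\<rho> n) - information (\<sigma> n)\<bar> / log 2 (real (d n))) \<longlonglongrightarrow> 0"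
  proof (rule real_tendsto_sandwich[OF _ _ tendsto_const lim])
    show "eventually (\<lambda>n. 0 \<le> \<bar>information (\<rho> n) - information (\<sigma> n)\<bar> / log 2 (real (d n))) sequentially"
      using ev by eventually_elim simp
    show "eventually (\<lambda>n. \<bar>information (\<rho> n) - information (\<sigma> n)\<bar> / log 2 (real (d n)) \<le> ?B n) sequentially"
      using ev
    proof eventually_elim
      case (elim n)
      have s: "is_state (d n) (\<rho> n)" "is_state (d n) (\<sigma> n)" using st by auto
      have dims: "dim_row (\<rho> n) = d n" "dim_row (\<sigma> n) = d n" using s by (auto simp: is_state_def)
      have L: "1 \<le> log 2 (real (d n))" using elim by (simp add: le_log_iff)
      have nn: "0 \<le> ?\<delta> n"
        by (rule trace_norm_diff_nonneg[OF s])
      have "\<bar>information (\<rho> n) - information (\<sigma> n)\<bar>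
          \<le> ?\<delta> n * log 2 (real (d n)) + (2 * sqrt (?\<delta> n) + ?\<delta> n) / ln 2"
        using entropy_diff_le[OF s] entropy_diff_le[OF s(2,1)] trace_norm_diff_commute[OF s]
        by (simp add: information_def dims abs_le_iff)
      then have "\<bar>information (\<rho> n) - information (\<sigma> n)\<bar> / log 2 (real (d n))
          \<le> ?\<delta> n + (2 * sqrt (?\<delta> n) + ?\<delta> n) / ln 2 / log 2 (real (d n))"
        using L by (simp add: field_simps)
      also have "(2 * sqrt (?\<delta> n) + ?\<delta> n) / ln 2 / log 2 (real (d n)) \<le> (2 * sqrt (?\<delta> n) + ?\<delta> n) / ln 2 / 1"
        using L nn by (intro divide_left_mono) auto
      finally show ?case by simp
    qed
  qed
qed

section \<open>Permuting the eigenvalues of a state with an ancilla\<close>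

definition perm_mat :: "nat \<Rightarrow> (nat \<Rightarrow> nat) \<Rightarrow> complex mat" where
  "perm_mat n s = mat n n (\<lambda>(i, j). if j = s i then 1 else 0)"

lemma perm_mat_carrier [simp]: "perm_mat n s \<in> carrier_mat n n"
  by (simp add: perm_mat_def)

lemma unitary_diag_perm_mat:
  assumes s: "bij_betw s {..<n} {..<n}"
  shows "unitary_diag n (perm_mat n s) r = mat_diag n (\<lambda>i. complex_of_real (r (s i)))"
proof (rule eq_matI)
  fix i j assume "i < dim_row (mat_diag n (\<lambda>i. complex_of_real (r (s i))))"
    "j < dim_col (mat_diag n (\<lambda>i. complex_of_real (r (s i))))"
  then have ij: "i < n" "j < n" by (auto simp: mat_diag_def)
  then have si: "s i < n" using bij_betwE[OF s] by auto
  have "unitary_diag n (perm_mat n s) r $$ (i, j)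
      = (\<Sum>k<n. perm_mat n s $$ (i, k) * of_real (r k) * cnj (perm_mat n s $$ (j, k)))"
    using ij by (simp add: unitary_diag_index)
  also have "\<dots> = (\<Sum>k<n. if k = s i then (if s i = s j then of_real (r k) else 0) else 0)"
    using ij by (intro sum.cong refl) (auto simp: perm_mat_def)
  also have "\<dots> = (if s i = s j then of_real (r (s i)) else 0)" using si by simp
  also have "s i = s j \<longleftrightarrow> i = j"
    using bij_betw_imp_inj_on[OF s] ij by (auto simp: inj_on_eq_iff)
  finally show "unitary_diag n (perm_mat n s) r $$ (i, j)
      = mat_diag n (\<lambda>i. complex_of_real (r (s i))) $$ (i, j)"
    using ij by (simp add: mat_diag_def)
qed (auto simp: perm_mat_def mat_diag_def)

lemma is_unitary_perm_mat:
  assumes "bij_betw s {..<n} {..<n}"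
  shows "is_unitary n (perm_mat n s)"
proof -
  have "perm_mat n s * mat_adjoint (perm_mat n s) = 1\<^sub>m n"
    using unitary_diag_perm_mat[OF assms, of "\<lambda>_. 1"]
    by (simp add: unitary_diag_def right_mult_one_mat[of _ n n])
  then have "is_unitary n (mat_adjoint (perm_mat n s))" by (intro is_unitaryI) simp_all
  from is_unitary_adjoint[OF this] show ?thesis by simp
qed

lemma partial_trace_mat_diag:
  "partial_trace a b (mat_diag (a * b) (\<lambda>x. complex_of_real (r x)))
    = mat_diag a (\<lambda>i. complex_of_real (\<Sum>k<b. r (i * b + k)))"
proof (rule eq_matI)
  fix i j assume "i < dim_row (mat_diag a (\<lambda>i. complex_of_real (\<Sum>k<b. r (i * b + k))))"
    "j < dim_col (mat_diag a (\<lambda>i. complex_of_real (\<Sum>k<b. r (i * b + k))))"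
  then have ij: "i < a" "j < a" by (auto simp: mat_diag_def)
  have "i * b + k = j * b + k \<longleftrightarrow> i = j" if "k < b" for k using that by auto
  then show "partial_trace a b (mat_diag (a * b) (\<lambda>x. complex_of_real (r x))) $$ (i, j)
      = mat_diag a (\<lambda>i. complex_of_real (\<Sum>k<b. r (i * b + k))) $$ (i, j)"
    using ij pair_index_less[of i a _ b] pair_index_less[of j a _ b]
    by (auto simp: partial_trace_def mat_diag_def)
qed (auto simp: partial_trace_def mat_diag_def)

lemma noisy_op_permute_spectrum:
  assumes U: "is_unitary D U" and W: "is_unitary a W" and K: "K \<ge> 1"
    and dims: "D * K = a * b" and s: "bij_betw s {..<a * b} {..<a * b}"
  shows "\<exists>L. noisy_op D a L \<and> (\<forall>p. L (unitary_diag D U p)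
    = unitary_diag a W (\<lambda>i. \<Sum>k<b. p (s (i * b + k) div K) / real K))"
proof -
  let ?P = "perm_mat (a * b) s"
  define L1 where "L1 \<rho> = mat_adjoint U * \<rho> * mat_adjoint (mat_adjoint U)" for \<rho>
  define L2 where "L2 \<rho> = tensor \<rho> (maximally_mixed K)" for \<rho>
  define L3 where "L3 \<rho> = partial_trace a b (?P * \<rho> * mat_adjoint ?P)" for \<rho>
  define L4 where "L4 \<rho> = W * \<rho> * mat_adjoint W" for \<rho>
  note Ud = is_unitaryD[OF U] and Wd = is_unitaryD[OF W]
  have n1: "noisy_op D D L1" unfolding L1_def by (intro noisy_op.unitary is_unitary_adjoint U)
  have n2: "noisy_op D (a * b) L2"
    unfolding L2_def dims[symmetric] by (intro noisy_op.ancilla K)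
  have n3: "noisy_op (a * b) a L3"
    unfolding L3_def by (intro noisy_op.discard is_unitary_perm_mat s)
  have n4: "noisy_op a a L4" unfolding L4_def by (intro noisy_op.unitary W)
  have "noisy_op D a (\<lambda>\<rho>. L4 (L3 (L2 (L1 \<rho>))))"
    using noisy_op.compose[OF noisy_op.compose[OF noisy_op.compose[OF n1 n2] n3] n4] .
  moreover have "L4 (L3 (L2 (L1 (unitary_diag D U p))))
    = unitary_diag a W (\<lambda>i. \<Sum>k<b. p (s (i * b + k) div K) / real K)" for p
  proof -
    have "L1 (unitary_diag D U p) = unitary_diag D (1\<^sub>m D) p"
      unfolding L1_def using conj_unitary_diag[of "mat_adjoint U" D U p] Ud by simp
    then have "L2 (L1 (unitary_diag D U p)) = unitary_diag (a * b) (1\<^sub>m (a * b)) (\<lambda>x. p (x div K) / real K)"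
      by (simp add: L2_def tensor_maximally_mixed tensor_one dims)
    then have "L3 (L2 (L1 (unitary_diag D U p)))
        = mat_diag a (\<lambda>i. complex_of_real (\<Sum>k<b. p (s (i * b + k) div K) / real K))"
      using conj_unitary_diag[of ?P "a * b" "1\<^sub>m (a * b)" "\<lambda>x. p (x div K) / real K"]
      by (simp only: L3_def perm_mat_carrier one_carrier_mat right_mult_one_mat[OF perm_mat_carrier]
          unitary_diag_perm_mat[OF s] partial_trace_mat_diag)
    then show ?thesis by (simp add: L4_def unitary_diag_def)
  qed
  ultimately show ?thesis by blast
qed

lemma bij_betw_extend_subset:
  assumes "finite X" "A \<subseteq> X" "B \<subseteq> X" "card A = card B"
  obtains s where "bij_betw s X X" "\<And>x. x \<in> X \<Longrightarrow> s x \<in> A \<longleftrightarrow> x \<in> B"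
proof -
  have fin: "finite A" "finite B" using assms finite_subset by auto
  obtain g where g: "bij_betw g B A" using finite_same_card_bij[OF fin(2,1)] assms(4) by auto
  have "card (X - B) = card (X - A)" using assms fin by (simp add: card_Diff_subset)
  then obtain h where h: "bij_betw h (X - B) (X - A)"
    using finite_same_card_bij[of "X - B" "X - A"] assms(1) by auto
  define s where "s x = (if x \<in> B then g x else h x)" for x
  have "bij_betw s B A" using g by (rule bij_betw_cong[THEN iffD1, rotated]) (simp add: s_def)
  moreover have "bij_betw s (X - B) (X - A)"
    using h by (rule bij_betw_cong[THEN iffD1, rotated]) (simp add: s_def)
  ultimately have "bij_betw s (B \<union> (X - B)) (A \<union> (X - A))" by (rule bij_betw_combine) auto
  then have "bij_betw s X X" using assms by (simp add: Un_absorb1)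
  moreover have "s x \<in> A \<longleftrightarrow> x \<in> B" if "x \<in> X" for x
    using that bij_betwE[OF g] bij_betwE[OF h] by (auto simp: s_def)
  ultimately show ?thesis using that by blast
qed

lemma card_pair_index:
  "card {x. x < a * b \<and> P (x div b) (x mod b)} = (\<Sum>i<a. card {k. k < (b :: nat) \<and> P i k})"
proof -
  have c: "card {x. x < n \<and> Q x} = (\<Sum>x<n. if Q x then 1 else 0)" for n :: nat and Q
  proof -
    have "(\<Sum>x<n. if Q x then 1 else 0) = (\<Sum>x\<in>{..<n} \<inter> {x. Q x}. 1 :: nat)"
      by (subst sum.inter_restrict) simp_all
    also have "{..<n} \<inter> {x. Q x} = {x. x < n \<and> Q x}" by auto
    finally show ?thesis by simp
  qed
  show ?thesis unfolding c sum_pair_index by (intro sum.cong refl) simp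
qed

lemma distill_pure:
  assumes U: "is_unitary D U" and W: "is_unitary M W" and z: "z < M"
    and p: "\<And>x. x < D \<Longrightarrow> 0 \<le> p x" "(\<Sum>x<D. p x) = 1"
    and T: "T \<subseteq> {..<D}" "card T * M \<le> D"
  shows "\<exists>L q. noisy_op D M L \<and> L (unitary_diag D U p) = unitary_diag M W q \<and>
    (\<forall>i<M. 0 \<le> q i) \<and> (\<Sum>i<M. q i) = 1 \<and> (\<Sum>x\<in>T. p x) \<le> q z"
proof -
  \<comment> \<open>With an ancilla of dimension \<open>M\<close> the part \<open>T\<close> of the spectrum occupies \<open>card T * M \<le> D\<close>
    basis vectors, which fit next to the basis vector \<open>z\<close> of the output; the ancilla of dimension
    \<open>D\<close> is then discarded.\<close>
  define A where "A = {x. x < D * M \<and> x div M \<in> T}"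
  have M: "0 < M" using z by simp
  have finT: "finite T" using T finite_subset by blast
  have "card A = (\<Sum>i<D. card {k. k < M \<and> i \<in> T})"
    unfolding A_def using card_pair_index[of D M "\<lambda>i k. i \<in> T"] by simp
  also have "\<dots> = (\<Sum>i<D. if i \<in> T then M else 0)" by (intro sum.cong refl) auto
  also have "\<dots> = (\<Sum>i\<in>{..<D} \<inter> T. M)" by (subst sum.inter_restrict) simp_all
  also have "\<dots> = card T * M" using T by (simp add: Int_absorb1)
  finally have cA: "card A = card T * M" .
  define B where "B = (\<lambda>k. z * D + k) ` {..<card A}"
  have cB: "card B = card A" by (simp add: B_def card_image)
  have B: "B \<subseteq> {..<M * D}"
    unfolding B_def using cA T(2) by (auto intro!: pair_index_less z)
  have A: "A \<subseteq> {..<M * D}" by (auto simp: A_def mult.commute)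
  obtain s where s: "bij_betw s {..<M * D} {..<M * D}" "\<And>x. x < M * D \<Longrightarrow> s x \<in> A \<longleftrightarrow> x \<in> B"
    using bij_betw_extend_subset[OF finite_lessThan A B] cB by auto
  have dims: "D * M = M * D" by simp
  obtain L where L: "noisy_op D M L" "\<And>p. L (unitary_diag D U p)
      = unitary_diag M W (\<lambda>i. \<Sum>k<D. p (s (i * D + k) div M) / real M)"
    using noisy_op_permute_spectrum[OF U W _ dims s(1)] M by auto
  define r where "r x = p (s x div M) / real M" for x
  have r0: "0 \<le> r x" if "x < M * D" for x
  proof -
    have "s x < D * M" using bij_betwE[OF s(1)] that by (auto simp: mult.commute)
    then show ?thesis unfolding r_def using p(1) by (simp add: less_mult_imp_div_less)
  qed
  have reindex: "(\<Sum>x\<in>X. r x) = (\<Sum>y\<in>s ` X. p (y div M) / real M)" if "X \<subseteq> {..<M * D}" for X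
    using inj_on_subset[OF bij_betw_imp_inj_on[OF s(1)] that] by (simp add: sum.reindex r_def)
  define q where "q i = (\<Sum>k<D. r (i * D + k))" for i
  have q0: "0 \<le> q i" if "i < M" for i
    unfolding q_def using that by (intro sum_nonneg r0 pair_index_less) auto
  have "(\<Sum>i<M. q i) = (\<Sum>x<M * D. r x)" by (simp add: q_def sum_pair_index)
  also have "\<dots> = (\<Sum>y<D * M. p (y div M) / real M)"
    using reindex[of "{..<M * D}"] s(1) by (simp add: bij_betw_imp_surj_on mult.commute)
  also have "\<dots> = 1" using M p(2) by (simp add: sum_pair_index)
  finally have q1: "(\<Sum>i<M. q i) = 1" .
  have "s ` B = A"
  proof
    show "s ` B \<subseteq> A" using B s(2) by auto
    show "A \<subseteq> s ` B"
    proof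
      fix y assume y: "y \<in> A"
      then have "y \<in> s ` {..<M * D}" using A s(1) by (auto simp: bij_betw_imp_surj_on)
      then show "y \<in> s ` B" using y s(2) by auto
    qed
  qed
  have "(\<Sum>x\<in>T. p x) = (\<Sum>i<D. if i \<in> T then p i else 0)"
    using T by (simp add: sum.inter_restrict[symmetric] Int_absorb1)
  also have "\<dots> = (\<Sum>y<D * M. if y div M \<in> T then p (y div M) / real M else 0)"
    unfolding sum_pair_index using M by (intro sum.cong refl) auto
  also have "\<dots> = (\<Sum>y\<in>{..<D * M} \<inter> {y. y div M \<in> T}. p (y div M) / real M)"
    by (subst sum.inter_restrict) simp_all
  also have "{..<D * M} \<inter> {y. y div M \<in> T} = A" by (auto simp: A_def)
  also have "(\<Sum>y\<in>A. p (y div M) / real M) = (\<Sum>x\<in>B. r x)"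
    using reindex[OF B] \<open>s ` B = A\<close> by simp
  also have "\<dots> = (\<Sum>k<card A. r (z * D + k))" by (simp add: B_def sum.reindex)
  also have "\<dots> \<le> q z"
    unfolding q_def using cA T(2) z by (intro sum_mono2 r0 pair_index_less) auto
  finally have "(\<Sum>x\<in>T. p x) \<le> q z" .
  moreover have "L (unitary_diag D U p) = unitary_diag M W q"
    using L(2)[of p] by (simp add: q_def[abs_def] r_def)
  ultimately show ?thesis using L(1) q0 q1 by blast
qed

lemma ex_between_sum_eq:
  fixes g :: "'a \<Rightarrow> nat"
  assumes "finite X" "\<And>x. x \<in> X \<Longrightarrow> g x \<le> b" "(\<Sum>x\<in>X. g x) \<le> K" "K \<le> card X * b"
  shows "\<exists>c. (\<forall>x\<in>X. g x \<le> c x \<and> c x \<le> b) \<and> (\<Sum>x\<in>X. c x) = K"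
  using assms(2,3)
proof (induction "K - (\<Sum>x\<in>X. g x)" arbitrary: g)
  case 0
  then show ?case by (intro exI[of _ g]) auto
next
  case (Suc n)
  have "\<exists>x\<in>X. g x < b"
  proof (rule ccontr)
    assume "\<not> (\<exists>x\<in>X. g x < b)"
    then have "(\<Sum>x\<in>X. g x) \<ge> (\<Sum>x\<in>X. b)" by (intro sum_mono) (simp add: not_less)
    then show False using Suc.hyps(2) assms(4) by simp
  qed
  then obtain x where x: "x \<in> X" "g x < b" by blast
  define h where "h = g(x := Suc (g x))"
  have sh: "(\<Sum>y\<in>X. h y) = Suc (\<Sum>y\<in>X. g y)"
    using x assms(1) by (simp add: h_def sum.remove[of X x])
  have "n = K - (\<Sum>y\<in>X. h y)" using Suc.hyps(2) sh by simp
  moreover have "h y \<le> b" if "y \<in> X" for y using x that Suc.prems(1) by (simp add: h_def)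
  moreover have "(\<Sum>y\<in>X. h y) \<le> K" using Suc.hyps(2) sh by simp
  ultimately obtain c where c: "\<forall>y\<in>X. h y \<le> c y \<and> c y \<le> b" "(\<Sum>y\<in>X. c y) = K"
    using Suc.hyps(1) by blast
  moreover have "g y \<le> h y" for y by (simp add: h_def)
  ultimately show ?case by (intro exI[of _ c]) (metis order_trans)
qed

lemma dilute_pure:
  assumes U: "is_unitary m U" and W: "is_unitary D W" and z: "z < m" and M: "0 < M"
    and p: "\<And>x. x < D \<Longrightarrow> 0 \<le> p x" "(\<Sum>x<D. p x) = 1"
  shows "\<exists>L q. noisy_op m D L \<and>
    L (unitary_diag m U (\<lambda>x. if x = z then 1 else 0)) = unitary_diag D W q \<and>
    (\<forall>i<D. 0 \<le> q i) \<and> (\<Sum>i<D. q i) = 1 \<and>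
    (\<Sum>i<D. \<bar>p i - q i\<bar>) \<le> 2 * ((\<Sum>x | x < D \<and> real m / real D < p x. p x) + 1 / real M)"
proof -
  have D: "0 < D" using p(2) by (cases D) auto
  \<comment> \<open>The input with ancilla is uniform on \<open>K\<close> basis vectors. Placing \<open>c i\<close> of them next to
    the output vector \<open>i\<close>, where at most \<open>b\<close> fit, yields the eigenvalue \<open>c i / K\<close>.\<close>
  define K where "K = D * M"
  define b where "b = m * M"
  have K: "0 < K" using D M by (simp add: K_def)
  have dims: "m * K = D * b" by (simp add: K_def b_def)
  define g where "g x = min b (nat \<lfloor>p x * real K\<rfloor>)" for x
  have gK: "real (g x) \<le> p x * real K" if "x < D" for x
  proof -
    have "0 \<le> p x * real K" using p(1)[OF that] by simp
    then have "real (nat \<lfloor>p x * real K\<rfloor>) \<le> p x * real K" by (simp add: of_nat_floor)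
    then show ?thesis by (simp add: g_def min_def)
  qed
  have "real (\<Sum>x<D. g x) \<le> (\<Sum>x<D. p x * real K)"
    unfolding of_nat_sum using gK by (intro sum_mono) simp
  also have "\<dots> = real K" using p(2) by (simp add: sum_distrib_right[symmetric])
  finally have "(\<Sum>x<D. g x) \<le> K" by (simp only: of_nat_le_iff)
  moreover have "K \<le> card {..<D} * b" using z by (simp add: K_def b_def)
  ultimately obtain c where c: "\<And>x. x < D \<Longrightarrow> g x \<le> c x" "\<And>x. x < D \<Longrightarrow> c x \<le> b" "(\<Sum>x<D. c x) = K"
    using ex_between_sum_eq[of "{..<D}" g b K] by (auto simp: g_def)
  define A where "A = (\<lambda>k. z * K + k) ` {..<K}"
  have A: "A \<subseteq> {..<D * b}" unfolding A_def dims[symmetric] using z by (auto intro!: pair_index_less)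
  define B where "B = {x. x < D * b \<and> x mod b < c (x div b)}"
  have "card B = (\<Sum>i<D. card {k. k < b \<and> k < c i})"
    unfolding B_def using card_pair_index[of D b "\<lambda>i k. k < c i"] by simp
  also have "\<dots> = (\<Sum>i<D. c i)"
  proof (intro sum.cong refl)
    fix i assume "i \<in> {..<D}"
    then have "{k. k < b \<and> k < c i} = {..<c i}" using c(2)[of i] by auto
    then show "card {k. k < b \<and> k < c i} = c i" by simp
  qed
  finally have "card A = card B" using c(3) by (simp add: A_def card_image)
  moreover have "B \<subseteq> {..<D * b}" by (auto simp: B_def)
  ultimately obtain s where s: "bij_betw s {..<D * b} {..<D * b}"
      "\<And>x. x < D * b \<Longrightarrow> s x \<in> A \<longleftrightarrow> x \<in> B"
    using bij_betw_extend_subset[OF finite_lessThan A] by (metis lessThan_iff)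
  obtain L where L: "noisy_op m D L" "\<And>p. L (unitary_diag m U p)
      = unitary_diag D W (\<lambda>i. \<Sum>k<b. p (s (i * b + k) div K) / real K)"
    using noisy_op_permute_spectrum[OF U W _ dims s(1)] K by auto
  define q where "q i = real (c i) / real K" for i
  have divA: "x div K = z \<longleftrightarrow> x \<in> A" for x
  proof
    assume "x div K = z"
    then have "x = z * K + x mod K" by (metis div_mult_mod_eq)
    moreover have "x mod K < K" using K by simp
    ultimately show "x \<in> A" unfolding A_def by blast
  qed (auto simp: A_def)
  have "(\<Sum>k<b. (if s (i * b + k) div K = z then 1 else 0) / real K) = q i" if i: "i < D" for i
  proof -
    have "(\<Sum>k<b. (if s (i * b + k) div K = z then 1 else 0) / real K)
        = (\<Sum>k<b. if k < c i then 1 / real K else 0)"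
    proof (intro sum.cong refl)
      fix k assume "k \<in> {..<b}"
      then have "k < b" by simp
      then show "(if s (i * b + k) div K = z then 1 else 0) / real K = (if k < c i then 1 / real K else 0)"
        unfolding divA using s(2)[OF pair_index_less[OF i \<open>k < b\<close>]] pair_index_less[OF i \<open>k < b\<close>]
        by (simp add: B_def)
    qed
    also have "\<dots> = (\<Sum>k\<in>{..<b} \<inter> {k. k < c i}. 1 / real K)" by (subst sum.inter_restrict) simp_all
    also have "{..<b} \<inter> {k. k < c i} = {..<c i}" using c(2)[OF i] by auto
    finally show ?thesis by (simp add: q_def)
  qed
  then have Lq: "L (unitary_diag m U (\<lambda>x. if x = z then 1 else 0)) = unitary_diag D W q"
    unfolding L(2) by (intro unitary_diag_cong) simp
  have q1: "(\<Sum>i<D. q i) = 1"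
  proof -
    have "(\<Sum>i<D. q i) = real (\<Sum>i<D. c i) / real K" by (simp add: q_def sum_divide_distrib)
    then show ?thesis using K by (simp add: c(3))
  qed
  let ?X = "{x. x < D \<and> real m / real D < p x}"
  have "(\<Sum>i<D. \<bar>p i - q i\<bar>) = (\<Sum>i<D. 2 * max (p i - q i) 0 - (p i - q i))"
    by (intro sum.cong refl) (simp add: abs_if max_def)
  also have "\<dots> = 2 * (\<Sum>i<D. max (p i - q i) 0)"
    using p(2) q1 by (simp add: sum_subtractf sum_distrib_left)
  also have "(\<Sum>i<D. max (p i - q i) 0) \<le> (\<Sum>i<D. (if i \<in> ?X then p i else 0) + 1 / real K)"
  proof (rule sum_mono)
    fix i assume "i \<in> {..<D}"
    then have i: "i < D" by simp
    have q0: "0 \<le> q i" by (simp add: q_def)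
    show "max (p i - q i) 0 \<le> (if i \<in> ?X then p i else 0) + 1 / real K"
    proof (cases "i \<in> ?X")
      case True
      have "max (p i - q i) 0 \<le> p i" "0 \<le> 1 / real K" using q0 p(1)[OF i] by auto
      then show ?thesis unfolding if_P[OF True] by linarith
    next
      case False
      then have "p i \<le> real m / real D" using i by simp
      then have "p i * real K \<le> real m / real D * real K" by (intro mult_right_mono) auto
      also have "\<dots> = real b" using D by (simp add: K_def b_def)
      finally have "g i = nat \<lfloor>p i * real K\<rfloor>" by (simp add: g_def min_def) linarith
      moreover have "p i * real K - 1 \<le> real (nat \<lfloor>p i * real K\<rfloor>)" by linarith
      ultimately have "p i * real K - 1 \<le> real (c i)" using c(1)[OF i] by linarith
      then have "p i \<le> (real (c i) + 1) / real K" using K by (simp add: pos_le_divide_eq)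
      then have "p i - q i \<le> 1 / real K" by (simp add: q_def add_divide_distrib)
      then show ?thesis using False by auto
    qed
  qed
  also have "\<dots> = (\<Sum>x\<in>{..<D} \<inter> ?X. p x) + real D / real K"
    by (subst sum.inter_restrict) (simp_all add: sum.distrib)
  also have "{..<D} \<inter> ?X = ?X" by auto
  also have "real D / real K = 1 / real M" using D by (simp add: K_def)
  finally have "(\<Sum>i<D. \<bar>p i - q i\<bar>) \<le> 2 * ((\<Sum>x\<in>?X. p x) + 1 / real M)" by simp
  then show ?thesis using L(1) Lq q1 by (intro exI[of _ L] exI[of _ q]) (simp add: q_def)
qed

section \<open>Typical eigenvalues of tensor powers\<close>

primrec product_weight :: "(nat \<Rightarrow> real) \<Rightarrow> nat \<Rightarrow> nat \<Rightarrow> nat \<Rightarrow> real" where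
  "product_weight p d 0 = (\<lambda>x. 1)"
| "product_weight p d (Suc n) = (\<lambda>x. p (x div d ^ n) * product_weight p d n (x mod d ^ n))"

primrec digit_sum :: "(nat \<Rightarrow> real) \<Rightarrow> nat \<Rightarrow> nat \<Rightarrow> nat \<Rightarrow> real" where
  "digit_sum y d 0 = (\<lambda>x. 0)"
| "digit_sum y d (Suc n) = (\<lambda>x. y (x div d ^ n) + digit_sum y d n (x mod d ^ n))"

lemma is_unitary_tensor_power: "is_unitary d U \<Longrightarrow> is_unitary (d ^ n) (tensor_power U n)"
  by (induction n) (auto intro: is_unitary_tensor)

lemma tensor_power_unitary_diag:
  assumes "is_unitary d U"
  shows "tensor_power (unitary_diag d U l) n
    = unitary_diag (d ^ n) (tensor_power U n) (product_weight l d n)"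
proof (induction n)
  case 0
  then show ?case by (simp add: unitary_diag_one)
next
  case (Suc n)
  then show ?case
    using tensor_unitary_diag[OF is_unitaryD(1)[OF assms] is_unitaryD(1)[OF is_unitary_tensor_power[OF assms]]]
    by simp
qed

context
  fixes p :: "nat \<Rightarrow> real" and d :: nat
  assumes p: "\<And>i. i < d \<Longrightarrow> 0 \<le> p i" "(\<Sum>i<d. p i) = 1"
begin

lemma product_weight_nonneg: "x < d ^ n \<Longrightarrow> 0 \<le> product_weight p d n x"
proof (induction n arbitrary: x)
  case (Suc n)
  then have x: "x < d * d ^ n" by simp
  then have "0 < d ^ n" by (cases "d ^ n") auto
  then show ?case using Suc.IH p(1) x by (simp add: less_mult_imp_div_less)
qed simp

lemma sum_product_weight: "(\<Sum>x<d ^ n. product_weight p d n x) = 1"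
proof (induction n)
  case (Suc n)
  have "(\<Sum>x<d ^ Suc n. product_weight p d (Suc n) x)
      = (\<Sum>i<d. \<Sum>k<d ^ n. p i * product_weight p d n k)"
    unfolding power_Suc sum_pair_index by (intro sum.cong refl) simp
  also have "\<dots> = 1" by (simp add: sum_distrib_left[symmetric] Suc p(2))
  finally show ?case .
qed simp

lemma product_weight_moments:
  assumes y: "(\<Sum>i<d. p i * y i) = 0"
  shows "(\<Sum>x<d ^ n. product_weight p d n x * digit_sum y d n x) = 0 \<and>
    (\<Sum>x<d ^ n. product_weight p d n x * (digit_sum y d n x)\<^sup>2) = real n * (\<Sum>i<d. p i * (y i)\<^sup>2)"
proof (induction n)
  case (Suc n)
  let ?w = "product_weight p d n" and ?s = "digit_sum y d n" and ?N = "d ^ n"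
  have "(\<Sum>x<d ^ Suc n. product_weight p d (Suc n) x * digit_sum y d (Suc n) x)
      = (\<Sum>i<d. \<Sum>k<?N. p i * y i * ?w k + p i * (?w k * ?s k))"
    unfolding power_Suc sum_pair_index by (intro sum.cong refl) (simp add: algebra_simps)
  also have "\<dots> = (\<Sum>i<d. p i * y i)"
    using Suc by (simp add: sum.distrib sum_distrib_left[symmetric] sum_product_weight)
  finally have 1: "(\<Sum>x<d ^ Suc n. product_weight p d (Suc n) x * digit_sum y d (Suc n) x) = 0"
    using y by simp
  have "(\<Sum>x<d ^ Suc n. product_weight p d (Suc n) x * (digit_sum y d (Suc n) x)\<^sup>2)
      = (\<Sum>i<d. \<Sum>k<?N. p i * (y i)\<^sup>2 * ?w k + 2 * p i * y i * (?w k * ?s k) + p i * (?w k * (?s k)\<^sup>2))"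
    unfolding power_Suc sum_pair_index
    by (intro sum.cong refl) (simp add: algebra_simps power2_eq_square)
  also have "\<dots> = (\<Sum>i<d. p i * (y i)\<^sup>2 + p i * (real n * (\<Sum>i<d. p i * (y i)\<^sup>2)))"
    using Suc by (simp add: sum.distrib sum_distrib_left[symmetric] sum_product_weight)
  also have "\<dots> = (\<Sum>i<d. p i * (y i)\<^sup>2) + real n * (\<Sum>i<d. p i * (y i)\<^sup>2)"
    by (simp add: sum.distrib sum_distrib_right[symmetric] p(2))
  finally show ?case using 1 by (simp add: algebra_simps)
qed simp

lemma log_product_weight:
  assumes "x < d ^ n" "0 < product_weight p d n x"
  shows "log 2 (product_weight p d n x) = digit_sum (\<lambda>i. log 2 (p i) + h) d n x - real n * h"
  using assms
proof (induction n arbitrary: x)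
  case (Suc n)
  let ?N = "d ^ n"
  have x: "x < d * ?N" using Suc.prems by simp
  then have "0 < ?N" by (cases ?N) auto
  then have m: "x mod ?N < ?N" by simp
  have "0 \<le> p (x div ?N)" "0 \<le> product_weight p d n (x mod ?N)"
    using p(1) x product_weight_nonneg[OF m] by (auto simp: less_mult_imp_div_less)
  moreover have "0 < p (x div ?N) * product_weight p d n (x mod ?N)" using Suc.prems by simp
  ultimately have "0 < p (x div ?N)" "0 < product_weight p d n (x mod ?N)"
    by (auto simp: zero_less_mult_iff)
  then show ?case using Suc.IH[OF m] by (simp add: log_mult algebra_simps)
qed simp

text \<open>Chebyshev's inequality for the sum of the logarithms of the eigenvalues.\<close>

lemma typical_weight:
  defines "h \<equiv> \<Sum>i<d. eta (p i)"
  shows "\<exists>V. \<forall>n \<epsilon>. 0 < n \<longrightarrow> 0 < \<epsilon> \<longrightarrow>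
    1 - V / (real n * \<epsilon>\<^sup>2) \<le> (\<Sum>x | x < d ^ n \<and>
      2 powr (- real n * (h + \<epsilon>)) \<le> product_weight p d n x \<and>
      product_weight p d n x \<le> 2 powr (- real n * (h - \<epsilon>)). product_weight p d n x)"
proof -
  define y where "y i = log 2 (p i) + h" for i
  define V where "V = (\<Sum>i<d. p i * (y i)\<^sup>2)"
  have "(\<Sum>i<d. p i * y i) = (\<Sum>i<d. p i * log 2 (p i)) + h"
    by (simp add: y_def distrib_left sum.distrib sum_distrib_right[symmetric] p(2))
  also have "\<dots> = 0" by (simp add: h_def eta_def sum_negf)
  finally have y0: "(\<Sum>i<d. p i * y i) = 0" .
  show ?thesis
  proof (intro exI[of _ V] allI impI)
    fix n :: nat and \<epsilon> :: real
    assume n: "0 < n" and \<epsilon>: "0 < \<epsilon>"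
    let ?w = "product_weight p d n" and ?s = "digit_sum y d n"
    let ?T = "{x. x < d ^ n \<and> 2 powr (- real n * (h + \<epsilon>)) \<le> ?w x \<and> ?w x \<le> 2 powr (- real n * (h - \<epsilon>))}"
    define c where "c = (real n * \<epsilon>)\<^sup>2"
    have c: "0 < c" using n \<epsilon> by (simp add: c_def)
    have "?w x \<le> (if x \<in> ?T then ?w x else 0) + ?w x * (?s x)\<^sup>2 / c" if x: "x < d ^ n" for x
    proof (cases "x \<in> ?T \<or> ?w x = 0")
      case True
      then show ?thesis using product_weight_nonneg[OF x] c by auto
    next
      case False
      then have w: "0 < ?w x" using product_weight_nonneg[OF x] by simp
      have lw: "log 2 (?w x) = ?s x - real n * h"
        unfolding y_def[abs_def] using log_product_weight[OF x w] .
      have pw: "?w x = 2 powr (?s x - real n * h)"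
        using w by (simp add: lw[symmetric])
      have "real n * \<epsilon> \<le> \<bar>?s x\<bar>"
      proof (rule ccontr)
        assume "\<not> real n * \<epsilon> \<le> \<bar>?s x\<bar>"
        then have "\<bar>?s x\<bar> < real n * \<epsilon>" by simp
        then have "x \<in> ?T" using x by (simp add: pw abs_less_iff algebra_simps)
        then show False using False by simp
      qed
      then have "c \<le> (?s x)\<^sup>2" unfolding c_def using n \<epsilon> by (metis abs_le_square_iff abs_of_nonneg less_imp_le mult_nonneg_nonneg of_nat_0_le_iff)
      then have "?w x * 1 \<le> ?w x * ((?s x)\<^sup>2 / c)" using w c by (intro mult_left_mono) auto
      then show ?thesis using False by auto
    qed
    then have "(\<Sum>x<d ^ n. ?w x) \<le> (\<Sum>x<d ^ n. (if x \<in> ?T then ?w x else 0) + ?w x * (?s x)\<^sup>2 / c)"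
      by (intro sum_mono) simp
    also have "\<dots> = (\<Sum>x<d ^ n. if x \<in> ?T then ?w x else 0) + real n * V / c"
      using product_weight_moments[OF y0, of n]
      by (simp add: sum.distrib sum_divide_distrib[symmetric] V_def)
    also have "(\<Sum>x<d ^ n. if x \<in> ?T then ?w x else 0) = (\<Sum>x\<in>{..<d ^ n} \<inter> ?T. ?w x)"
      by (subst sum.inter_restrict) simp_all
    also have "{..<d ^ n} \<inter> ?T = ?T" by auto
    also have "real n * V / c = V / (real n * \<epsilon>\<^sup>2)"
      using n by (simp add: c_def power2_eq_square)
    finally show "1 - V / (real n * \<epsilon>\<^sup>2) \<le> (\<Sum>x\<in>?T. ?w x)" by (simp add: sum_product_weight)
  qed
qed

end

section \<open>Pure states\<close>

lemma pure_state_unitary_diag: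
  assumes "pure_state d \<rho>"
  shows "\<exists>U. is_unitary d U \<and> \<rho> = unitary_diag d U (\<lambda>i. if i = 0 then 1 else 0)"
proof -
  obtain \<psi> where \<psi>: "\<psi> \<in> carrier_vec d" "\<psi> \<bullet>c \<psi> = 1"
    and \<rho>: "\<rho> = mat d d (\<lambda>(i, j). \<psi> $ i * cnj (\<psi> $ j))"
    using assms by (auto simp: pure_state_def)
  have "\<psi> \<noteq> 0\<^sub>v d" using \<psi> by auto
  then obtain W c where W: "is_unitary d W" "col W 0 = c \<cdot>\<^sub>v \<psi>"
    using unitary_completion[OF \<psi>(1)] by blast
  note Wd = is_unitaryD[OF W(1)]
  have d: "0 < d" using \<psi> by (cases d) (auto simp: scalar_prod_def)
  have Wi: "W $$ (i, 0) = c * \<psi> $ i" if "i < d" for i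
    using arg_cong[OF W(2), of "\<lambda>v. v $ i"] that Wd(1) \<psi>(1) d by simp
  have "complex_of_real (\<Sum>i<d. (cmod (\<psi> $ i))\<^sup>2) = \<psi> \<bullet>c \<psi>"
    using \<psi>(1) by (simp only: of_real_sum complex_norm_square) (simp add: scalar_prod_def lessThan_atLeast0)
  then have n: "(\<Sum>i<d. (cmod (\<psi> $ i))\<^sup>2) = 1" using \<psi>(2) by (metis of_real_eq_1_iff)
  have "1 = (\<Sum>i<d. (cmod (W $$ (i, 0)))\<^sup>2)" using is_unitary_col_norm[OF W(1) d] by simp
  also have "\<dots> = (\<Sum>i<d. (cmod c)\<^sup>2 * (cmod (\<psi> $ i))\<^sup>2)"
    by (intro sum.cong refl) (simp add: Wi norm_mult power_mult_distrib)
  also have "\<dots> = (cmod c)\<^sup>2" by (simp add: sum_distrib_left[symmetric] n)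
  finally have c: "c * cnj c = 1" by (simp add: complex_norm_square[symmetric])
  have "\<rho> = unitary_diag d W (\<lambda>i. if i = 0 then 1 else 0)"
  proof (rule eq_matI)
    fix i j assume "i < dim_row (unitary_diag d W (\<lambda>i. if i = 0 then 1 else 0))"
      "j < dim_col (unitary_diag d W (\<lambda>i. if i = 0 then 1 else 0))"
    then have ij: "i < d" "j < d" using Wd(1) by auto
    have "unitary_diag d W (\<lambda>i. if i = 0 then 1 else 0) $$ (i, j)
        = (\<Sum>k<d. if k = 0 then W $$ (i, k) * cnj (W $$ (j, k)) else 0)"
      unfolding unitary_diag_index[OF Wd(1) ij] by (intro sum.cong refl) simp
    also have "\<dots> = (c * cnj c) * (\<psi> $ i * cnj (\<psi> $ j))" using d ij by (simp add: Wi)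
    finally show "\<rho> $$ (i, j) = unitary_diag d W (\<lambda>i. if i = 0 then 1 else 0) $$ (i, j)"
      using ij by (simp add: c \<rho>)
  qed (use Wd(1) \<rho> in auto)
  then show ?thesis using W(1) by blast
qed

lemma product_weight_indicator:
  assumes "x < d ^ n"
  shows "product_weight (\<lambda>i. if i = 0 then 1 else 0) d n x = (if x = 0 then 1 else 0)"
  using assms
proof (induction n arbitrary: x)
  case (Suc n)
  then have x: "x < d * d ^ n" by simp
  then have N: "0 < d ^ n" by (cases "d ^ n") auto
  have "x = 0 \<longleftrightarrow> x div d ^ n = 0 \<and> x mod d ^ n = 0"
    using N by (metis div_0 div_mult_mod_eq add_0 mod_0 mult_0)
  then show ?case using Suc.IH[of "x mod d ^ n"] N by auto
qed simp

lemma is_state_oneD: "is_state 1 A \<Longrightarrow> A = 1\<^sub>m 1"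
  by (intro eq_matI) (auto simp: is_state_def mat_trace_def)

lemma is_state_tensor_power:
  assumes "is_state d \<rho>"
  shows "is_state (d ^ n) (tensor_power \<rho> n)"
proof -
  obtain U l where U: "is_unitary d U" "\<rho> = unitary_diag d U l" "\<And>i. i < d \<Longrightarrow> 0 \<le> l i" "(\<Sum>i<d. l i) = 1"
    using is_state_unitary_diagE[OF assms] by blast
  then show ?thesis
    by (simp add: tensor_power_unitary_diag is_state_unitary_diagI is_unitary_tensor_power
        product_weight_nonneg sum_product_weight)
qed

section \<open>Asymptotic conversion to and from pure qubits\<close>

lemma real_power_eq_powr: "0 < d \<Longrightarrow> real (d ^ n) = 2 powr (real n * log 2 (real d))"
  by (simp add: powr_realpow[symmetric] powr_def log_def)

lemma tensor_power_pure_qubit: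
  assumes "is_unitary 2 W"
  shows "tensor_power (unitary_diag 2 W (\<lambda>i. if i = 0 then 1 else 0)) m
    = unitary_diag (2 ^ m) (tensor_power W m) (\<lambda>i. if i = 0 then 1 else 0)"
  unfolding tensor_power_unitary_diag[OF assms]
  by (intro unitary_diag_cong product_weight_indicator)

lemma distill_rate:
  assumes \<rho>: "is_state d \<rho>" and \<pi>: "pure_state 2 \<pi>"
  shows "\<exists>V. \<forall>n \<epsilon> m. 0 < n \<longrightarrow> 0 < \<epsilon> \<longrightarrow> real m \<le> real n * (information \<rho> - \<epsilon>) \<longrightarrow>
    (\<exists>L. noisy_op (d ^ n) (2 ^ m) L \<and>
      trace_norm (tensor_power \<pi> m - L (tensor_power \<rho> n)) \<le> V / (real n * \<epsilon>\<^sup>2))"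
proof -
  obtain W where W: "is_unitary 2 W" "\<pi> = unitary_diag 2 W (\<lambda>i. if i = 0 then 1 else 0)"
    using pure_state_unitary_diag[OF \<pi>] by blast
  obtain U l where U: "is_unitary d U" "\<rho> = unitary_diag d U l"
    and l: "\<And>i. i < d \<Longrightarrow> 0 \<le> l i" "(\<Sum>i<d. l i) = 1"
    using is_state_unitary_diagE[OF \<rho>] by blast
  have d: "0 < d" using is_state_dim_pos[OF \<rho>] .
  define h where "h = (\<Sum>i<d. eta (l i))"
  have I: "information \<rho> = log 2 (real d) - h"
    unfolding U(2) information_unitary_diag[OF U(1)] h_def ..
  obtain V where V: "\<And>n \<epsilon>. 0 < n \<Longrightarrow> 0 < \<epsilon> \<Longrightarrow> 1 - V / (real n * \<epsilon>\<^sup>2) \<le> (\<Sum>x | x < d ^ n \<and>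
      2 powr (- real n * (h + \<epsilon>)) \<le> product_weight l d n x \<and>
      product_weight l d n x \<le> 2 powr (- real n * (h - \<epsilon>)). product_weight l d n x)"
    using typical_weight[OF l] unfolding h_def by blast
  show ?thesis
  proof (intro exI[of _ "2 * V"] allI impI)
    fix n m :: nat and \<epsilon> :: real
    assume n: "0 < n" and \<epsilon>: "0 < \<epsilon>" and m: "real m \<le> real n * (information \<rho> - \<epsilon>)"
    let ?w = "product_weight l d n"
    define T where "T = {x. x < d ^ n \<and> 2 powr (- real n * (h + \<epsilon>)) \<le> ?w x
      \<and> ?w x \<le> 2 powr (- real n * (h - \<epsilon>))}"
    have T: "T \<subseteq> {..<d ^ n}" by (auto simp: T_def)
    have wT: "1 - V / (real n * \<epsilon>\<^sup>2) \<le> (\<Sum>x\<in>T. ?w x)" using V[OF n \<epsilon>] by (simp add: T_def)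
    have "real (card T) * 2 powr (- real n * (h + \<epsilon>)) = (\<Sum>x\<in>T. 2 powr (- real n * (h + \<epsilon>)))"
      by simp
    also have "\<dots> \<le> (\<Sum>x\<in>T. ?w x)" by (intro sum_mono) (simp add: T_def)
    also have "\<dots> \<le> (\<Sum>x<d ^ n. ?w x)"
      using T product_weight_nonneg[OF l] by (intro sum_mono2) auto
    finally have "real (card T) * 2 powr (- real n * (h + \<epsilon>)) \<le> 1" by (simp add: sum_product_weight[OF l])
    then have "real (card T) * 2 powr (- real n * (h + \<epsilon>)) * 2 powr (real n * log 2 (real d))
        \<le> 1 * 2 powr (real n * log 2 (real d))"
      by (intro mult_right_mono) auto
    then have "real (card T) * 2 powr (real n * (information \<rho> - \<epsilon>)) \<le> real (d ^ n)"
      unfolding real_power_eq_powr[OF d] I mult.assoc powr_add[symmetric] by (simp add: algebra_simps)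
    moreover have "real (2 ^ m) \<le> 2 powr (real n * (information \<rho> - \<epsilon>))"
      using m by (simp add: powr_realpow[symmetric])
    then have "real (card T) * real (2 ^ m) \<le> real (card T) * 2 powr (real n * (information \<rho> - \<epsilon>))"
      by (intro mult_left_mono) auto
    ultimately have "real (card T * 2 ^ m) \<le> real (d ^ n)" by simp
    then have cT: "card T * 2 ^ m \<le> d ^ n" by (simp only: of_nat_le_iff)
    have z: "(0 :: nat) < 2 ^ m" by simp
    obtain L q where L: "noisy_op (d ^ n) (2 ^ m) L"
      "L (unitary_diag (d ^ n) (tensor_power U n) ?w) = unitary_diag (2 ^ m) (tensor_power W m) q"
      and q: "\<forall>i<2 ^ m. 0 \<le> q i" "(\<Sum>i<2 ^ m. q i) = 1" "(\<Sum>x\<in>T. ?w x) \<le> q 0"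
      using distill_pure[OF is_unitary_tensor_power[OF U(1)] is_unitary_tensor_power[OF W(1)] z
          product_weight_nonneg[OF l] sum_product_weight[OF l] T cT] by blast
    have "trace_norm (tensor_power \<pi> m - L (tensor_power \<rho> n))
        = (\<Sum>i<2 ^ m. \<bar>(if i = 0 then 1 else 0) - q i\<bar>)"
      unfolding U(2) tensor_power_unitary_diag[OF U(1)] L(2) W(2) tensor_power_pure_qubit[OF W(1)]
        unitary_diag_diff[OF is_unitary_tensor_power[OF W(1)]]
      by (rule trace_norm_unitary_diag[OF is_unitary_tensor_power[OF W(1)]])
    also have "\<dots> = \<bar>1 - q 0\<bar> + (\<Sum>i\<in>{..<2 ^ m} - {0}. \<bar>(if i = 0 then 1 else 0) - q i\<bar>)"
      by (subst sum.remove[of _ 0]) auto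
    also have "(\<Sum>i\<in>{..<2 ^ m} - {0}. \<bar>(if i = 0 then 1 else 0) - q i\<bar>) = (\<Sum>i\<in>{..<2 ^ m} - {0}. q i)"
      using q(1) by (intro sum.cong refl) auto
    also have "\<dots> = 1 - q 0" using q(2) by (simp add: sum.remove[of "{..<2 ^ m}" 0])
    finally have tn: "trace_norm (tensor_power \<pi> m - L (tensor_power \<rho> n)) = \<bar>1 - q 0\<bar> + (1 - q 0)" .
    have "q 0 \<le> 1" using member_le_sum[of 0 "{..<2 ^ m}" q] q(1,2) by simp
    then have "trace_norm (tensor_power \<pi> m - L (tensor_power \<rho> n)) \<le> 2 * V / (real n * \<epsilon>\<^sup>2)"
      using tn wT q(3) by simp
    then show "\<exists>L. noisy_op (d ^ n) (2 ^ m) L \<and>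
        trace_norm (tensor_power \<pi> m - L (tensor_power \<rho> n)) \<le> 2 * V / (real n * \<epsilon>\<^sup>2)"
      using L(1) by blast
  qed
qed

lemma dilute_rate:
  assumes \<rho>: "is_state d \<rho>" and \<pi>: "pure_state 2 \<pi>"
  shows "\<exists>V. \<forall>n \<epsilon> m. 0 < n \<longrightarrow> 0 < \<epsilon> \<longrightarrow> real n * (information \<rho> + \<epsilon>) \<le> real m \<longrightarrow>
    (\<exists>L. noisy_op (2 ^ m) (d ^ n) L \<and>
      trace_norm (tensor_power \<rho> n - L (tensor_power \<pi> m)) \<le> V / (real n * \<epsilon>\<^sup>2) + 2 / real n)"
proof -
  obtain W where W: "is_unitary 2 W" "\<pi> = unitary_diag 2 W (\<lambda>i. if i = 0 then 1 else 0)"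
    using pure_state_unitary_diag[OF \<pi>] by blast
  obtain U l where U: "is_unitary d U" "\<rho> = unitary_diag d U l"
    and l: "\<And>i. i < d \<Longrightarrow> 0 \<le> l i" "(\<Sum>i<d. l i) = 1"
    using is_state_unitary_diagE[OF \<rho>] by blast
  have d: "0 < d" using is_state_dim_pos[OF \<rho>] .
  define h where "h = (\<Sum>i<d. eta (l i))"
  have I: "information \<rho> = log 2 (real d) - h"
    unfolding U(2) information_unitary_diag[OF U(1)] h_def ..
  obtain V where V: "\<And>n \<epsilon>. 0 < n \<Longrightarrow> 0 < \<epsilon> \<Longrightarrow> 1 - V / (real n * \<epsilon>\<^sup>2) \<le> (\<Sum>x | x < d ^ n \<and>
      2 powr (- real n * (h + \<epsilon>)) \<le> product_weight l d n x \<and>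
      product_weight l d n x \<le> 2 powr (- real n * (h - \<epsilon>)). product_weight l d n x)"
    using typical_weight[OF l] unfolding h_def by blast
  show ?thesis
  proof (intro exI[of _ "2 * V"] allI impI)
    fix n m :: nat and \<epsilon> :: real
    assume n: "0 < n" and \<epsilon>: "0 < \<epsilon>" and m: "real n * (information \<rho> + \<epsilon>) \<le> real m"
    let ?w = "product_weight l d n"
    define T where "T = {x. x < d ^ n \<and> 2 powr (- real n * (h + \<epsilon>)) \<le> ?w x
      \<and> ?w x \<le> 2 powr (- real n * (h - \<epsilon>))}"
    define X where "X = {x. x < d ^ n \<and> real (2 ^ m) / real (d ^ n) < ?w x}"
    have wT: "1 - V / (real n * \<epsilon>\<^sup>2) \<le> (\<Sum>x\<in>T. ?w x)" using V[OF n \<epsilon>] by (simp add: T_def)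
    have "2 powr (- real n * (h - \<epsilon>)) = 2 powr (real n * (information \<rho> + \<epsilon>)) / real (d ^ n)"
      unfolding real_power_eq_powr[OF d] I powr_diff[symmetric] by (simp add: algebra_simps)
    also have "\<dots> \<le> 2 powr real m / real (d ^ n)" using m by (intro divide_right_mono) auto
    finally have "2 powr (- real n * (h - \<epsilon>)) \<le> real (2 ^ m) / real (d ^ n)" by (simp add: powr_realpow)
    then have "X \<subseteq> {..<d ^ n} - T" by (auto simp: X_def T_def)
    then have "(\<Sum>x\<in>X. ?w x) \<le> (\<Sum>x\<in>{..<d ^ n} - T. ?w x)"
      using product_weight_nonneg[OF l] by (intro sum_mono2) auto
    also have "\<dots> = (\<Sum>x<d ^ n. ?w x) - (\<Sum>x\<in>T. ?w x)"
      by (intro sum_diff) (auto simp: T_def)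
    finally have X: "(\<Sum>x\<in>X. ?w x) \<le> V / (real n * \<epsilon>\<^sup>2)"
      using wT by (simp add: sum_product_weight[OF l])
    obtain L q where L: "noisy_op (2 ^ m) (d ^ n) L"
      "L (unitary_diag (2 ^ m) (tensor_power W m) (\<lambda>i. if i = 0 then 1 else 0))
        = unitary_diag (d ^ n) (tensor_power U n) q"
      and q: "(\<Sum>i<d ^ n. \<bar>?w i - q i\<bar>) \<le> 2 * ((\<Sum>x\<in>X. ?w x) + 1 / real n)"
      using dilute_pure[OF is_unitary_tensor_power[OF W(1)] is_unitary_tensor_power[OF U(1)] _ n
          product_weight_nonneg[OF l] sum_product_weight[OF l], of 0 m n] unfolding X_def by auto
    have "trace_norm (tensor_power \<rho> n - L (tensor_power \<pi> m)) = (\<Sum>i<d ^ n. \<bar>?w i - q i\<bar>)"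
      unfolding U(2) tensor_power_unitary_diag[OF U(1)] W(2) tensor_power_pure_qubit[OF W(1)] L(2)
        unitary_diag_diff[OF is_unitary_tensor_power[OF U(1)]]
      by (rule trace_norm_unitary_diag[OF is_unitary_tensor_power[OF U(1)]])
    also have "\<dots> \<le> 2 * V / (real n * \<epsilon>\<^sup>2) + 2 / real n" using q X by simp
    finally show "\<exists>L. noisy_op (2 ^ m) (d ^ n) L \<and>
        trace_norm (tensor_power \<rho> n - L (tensor_power \<pi> m)) \<le> 2 * V / (real n * \<epsilon>\<^sup>2) + 2 / real n"
      using L(1) by blast
  qed
qed

lemma pure_qubit_is_state:
  assumes "pure_state 2 \<pi>"
  shows "is_state 2 \<pi>"
proof -
  obtain W where W: "is_unitary 2 W" "\<pi> = unitary_diag 2 W (\<lambda>i. if i = 0 then 1 else 0)"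
    using pure_state_unitary_diag[OF assms] by blast
  have "(\<Sum>i<2::nat. (if i = 0 then 1 else 0 :: real)) = 1" by (simp add: numeral_2_eq_2)
  then show ?thesis unfolding W(2) by (intro is_state_unitary_diagI W(1)) auto
qed

lemma information_nonneg:
  assumes "is_state d \<rho>"
  shows "0 \<le> information \<rho>"
proof -
  obtain U l where U: "is_unitary d U" "\<rho> = unitary_diag d U l"
    and l: "\<And>i. i < d \<Longrightarrow> 0 \<le> l i" "(\<Sum>i<d. l i) = 1"
    using is_state_unitary_diagE[OF assms] by blast
  show ?thesis unfolding U(2) information_unitary_diag[OF U(1)] using sum_eta_le_log[OF l] by simp
qed

lemma filterlim_at_top_of_ratio:
  assumes "(\<lambda>n. real (m n) / real n) \<longlonglongrightarrow> c" "0 < c"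
  shows "filterlim m at_top sequentially"
proof -
  have "filterlim (\<lambda>n. real (m n) / real n * real n) at_top sequentially"
    by (rule filterlim_tendsto_pos_mult_at_top[OF assms filterlim_real_sequentially])
  then have "filterlim (\<lambda>n. real (m n)) at_top sequentially"
    by (rule filterlim_at_top_mono) simp
  then show ?thesis by (simp add: filterlim_sequentially_iff_filterlim_real)
qed

lemma filterlim_power_nat_at_top:
  assumes "2 \<le> (d :: nat)"
  shows "filterlim (\<lambda>n. d ^ n) at_top sequentially"
proof (rule filterlim_at_top_mono[OF filterlim_ident])
  have "n \<le> d ^ n" for n
    using less_exp[of n] power_mono[of 2 d n] assms by (meson le_trans less_imp_le zero_le)
  then show "eventually (\<lambda>n. n \<le> d ^ n) sequentially" by simp
qed

section \<open>Uniqueness of the regularized monotone\<close>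

locale continuous_monotone =
  fixes f :: "complex mat \<Rightarrow> real"
  assumes nonincreasing: "nonincreasing_under_NO f"
    and continuous: "asymptotically_continuous f"
    and regularizable: "is_state d \<rho> \<Longrightarrow> regularization_exists f \<rho>"
begin

lemma noisy_op_le: "noisy_op d e L \<Longrightarrow> is_state d \<rho> \<Longrightarrow> f (L \<rho>) \<le> f \<rho>"
  using nonincreasing by (auto simp: nonincreasing_under_NO_def)

lemma continuous_sequence:
  assumes "\<And>n. is_state (d n) (\<rho> n)" "\<And>n. is_state (d n) (\<sigma> n)"
    and "filterlim d at_top sequentially"
    and "(\<lambda>n. trace_norm (\<rho> n - \<sigma> n)) \<longlonglongrightarrow> 0"
  shows "(\<lambda>n. \<bar>f (\<rho> n) - f (\<sigma> n)\<bar> / log 2 (real (d n))) \<longlonglongrightarrow> 0"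
  using continuous assms by (auto simp: asymptotically_continuous_def)

lemma regularization_tendsto:
  "is_state d \<rho> \<Longrightarrow> (\<lambda>n. f (tensor_power \<rho> n) / real n) \<longlonglongrightarrow> regularization f \<rho>"
  using regularizable
  by (simp add: regularization_def regularization_exists_def convergent_LIMSEQ_iff)

lemma regularization_subsequence:
  assumes "is_state d \<rho>" "filterlim m at_top sequentially"
    and "(\<lambda>n. real (m n) / real n) \<longlonglongrightarrow> r"
  shows "(\<lambda>n. f (tensor_power \<rho> (m n)) / real n) \<longlonglongrightarrow> regularization f \<rho> * r"
proof -
  have "(\<lambda>n. f (tensor_power \<rho> (m n)) / real (m n) * (real (m n) / real n)) \<longlonglongrightarrow> regularization f \<rho> * r"
    by (intro tendsto_mult assms(3) filterlim_compose[OF regularization_tendsto[OF assms(1)] assms(2)])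
  moreover have "eventually (\<lambda>n. 1 \<le> m n) sequentially" using assms(2) by (simp add: filterlim_at_top)
  then have "eventually (\<lambda>n. f (tensor_power \<rho> (m n)) / real (m n) * (real (m n) / real n)
      = f (tensor_power \<rho> (m n)) / real n) sequentially"
    by eventually_elim simp
  ultimately show ?thesis by (rule Lim_transform_eventually)
qed

lemma regularization_dim_one:
  assumes "is_state 1 \<rho>"
  shows "regularization f \<rho> = 0"
proof -
  have "tensor_power \<rho> n = 1\<^sub>m 1" for n
    using is_state_oneD is_state_tensor_power[OF assms, of n] by simp
  then have "(\<lambda>n. f (1\<^sub>m 1) / real n) \<longlonglongrightarrow> regularization f \<rho>"
    using regularization_tendsto[OF assms] by simp
  moreover have "(\<lambda>n. f (1\<^sub>m 1) / real n) \<longlonglongrightarrow> 0" by (rule lim_const_over_n)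
  ultimately show ?thesis by (rule LIMSEQ_unique)
qed

lemma regularization_nonneg:
  assumes "is_state d \<rho>"
  shows "0 \<le> regularization f \<rho>"
proof (rule LIMSEQ_le)
  show "(\<lambda>n. f (1\<^sub>m 1) / real n) \<longlonglongrightarrow> 0" by (rule lim_const_over_n)
  show "(\<lambda>n. f (tensor_power \<rho> n) / real n) \<longlonglongrightarrow> regularization f \<rho>"
    by (rule regularization_tendsto[OF assms])
  have "f (1\<^sub>m 1) \<le> f (tensor_power \<rho> n)" for n
  proof -
    have st: "is_state (1 * d ^ n) (tensor_power \<rho> n)" using is_state_tensor_power[OF assms] by simp
    let ?L = "\<lambda>\<rho>. partial_trace 1 (d ^ n) (1\<^sub>m (1 * d ^ n) * \<rho> * mat_adjoint (1\<^sub>m (1 * d ^ n)))"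
    have L: "noisy_op (1 * d ^ n) 1 ?L" by (rule noisy_op.discard[OF is_unitary_one])
    then have "?L (tensor_power \<rho> n) = 1\<^sub>m 1"
      using noisy_op_state_information[OF L st] is_state_oneD by blast
    then show ?thesis using noisy_op_le[OF L st] by simp
  qed
  then show "\<exists>N. \<forall>n\<ge>N. f (1\<^sub>m 1) / real n \<le> f (tensor_power \<rho> n) / real n"
    by (intro exI[of _ 0] allI impI divide_right_mono) auto
qed

lemma regularization_le:
  assumes \<rho>: "is_state d \<rho>" and d: "2 \<le> d" and \<pi>: "pure_state 2 \<pi>" and \<epsilon>: "0 < \<epsilon>"
  shows "regularization f \<rho> \<le> regularization f \<pi> * (information \<rho> + \<epsilon>)"
proof -
  note st\<pi> = pure_qubit_is_state[OF \<pi>]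
  define c where "c = information \<rho> + \<epsilon>"
  have c: "0 < c" using information_nonneg[OF \<rho>] \<epsilon> by (simp add: c_def)
  define m where "m n = nat \<lceil>real n * c\<rceil>" for n
  have m: "real n * c \<le> real (m n)" "real (m n) \<le> real n * c + 1" for n
    using c by (auto simp: m_def le_of_int_ceiling real_nat_ceiling_ge of_int_ceiling_le_add_one)
  have ratio: "(\<lambda>n. real (m n) / real n) \<longlonglongrightarrow> c"
  proof (rule real_tendsto_sandwich)
    show "(\<lambda>n. c) \<longlonglongrightarrow> c" by simp
    have "(\<lambda>n. c + 1 / real n) \<longlonglongrightarrow> c + 0" by (intro tendsto_intros lim_const_over_n)
    then show "(\<lambda>n. c + 1 / real n) \<longlonglongrightarrow> c" by simp
    show "eventually (\<lambda>n. c \<le> real (m n) / real n) sequentially"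
      using eventually_gt_at_top[of 0] by eventually_elim (use m(1) in \<open>simp add: field_simps\<close>)
    show "eventually (\<lambda>n. real (m n) / real n \<le> c + 1 / real n) sequentially"
      using eventually_gt_at_top[of 0] by eventually_elim (use m(2) in \<open>simp add: field_simps\<close>)
  qed
  have mtop: "filterlim m at_top sequentially" by (rule filterlim_at_top_of_ratio[OF ratio c])
  obtain V where V: "\<And>n \<epsilon> m. 0 < n \<Longrightarrow> 0 < \<epsilon> \<Longrightarrow> real n * (information \<rho> + \<epsilon>) \<le> real m \<Longrightarrow>
    \<exists>L. noisy_op (2 ^ m) (d ^ n) L \<and>
      trace_norm (tensor_power \<rho> n - L (tensor_power \<pi> m)) \<le> V / (real n * \<epsilon>\<^sup>2) + 2 / real n"
    using dilute_rate[OF \<rho> \<pi>] by blast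
  have "\<exists>\<sigma>. is_state (d ^ n) \<sigma> \<and> (0 < n \<longrightarrow> f \<sigma> \<le> f (tensor_power \<pi> (m n)) \<and>
      trace_norm (tensor_power \<rho> n - \<sigma>) \<le> V / (real n * \<epsilon>\<^sup>2) + 2 / real n)" for n
  proof (cases "0 < n")
    case True
    have "is_state (2 ^ m n) (tensor_power \<pi> (m n))" using is_state_tensor_power[OF st\<pi>] .
    then show ?thesis
      using V[OF True \<epsilon> m(1)[of n, unfolded c_def]] noisy_op_le noisy_op_state_information by blast
  next
    case False
    then show ?thesis using is_state_tensor_power[OF \<rho>] by blast
  qed
  then obtain \<sigma> where \<sigma>: "\<And>n. is_state (d ^ n) (\<sigma> n)"
    "\<And>n. 0 < n \<Longrightarrow> f (\<sigma> n) \<le> f (tensor_power \<pi> (m n))"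
    "\<And>n. 0 < n \<Longrightarrow> trace_norm (tensor_power \<rho> n - \<sigma> n) \<le> V / (real n * \<epsilon>\<^sup>2) + 2 / real n"
    by metis
  have "(\<lambda>n. trace_norm (tensor_power \<rho> n - \<sigma> n)) \<longlonglongrightarrow> 0"
  proof (rule real_tendsto_sandwich[OF _ _ tendsto_const])
    have "(\<lambda>n. V / \<epsilon>\<^sup>2 / real n + 2 / real n) \<longlonglongrightarrow> 0 + 0" by (intro tendsto_add lim_const_over_n)
    then show "(\<lambda>n. V / (real n * \<epsilon>\<^sup>2) + 2 / real n) \<longlonglongrightarrow> 0" by (simp add: mult.commute)
    show "eventually (\<lambda>n. 0 \<le> trace_norm (tensor_power \<rho> n - \<sigma> n)) sequentially"
      using trace_norm_diff_nonneg[OF is_state_tensor_power[OF \<rho>] \<sigma>(1)] by simp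
    show "eventually (\<lambda>n. trace_norm (tensor_power \<rho> n - \<sigma> n) \<le> V / (real n * \<epsilon>\<^sup>2) + 2 / real n) sequentially"
      using eventually_gt_at_top[of 0] by eventually_elim (rule \<sigma>(3))
  qed
  moreover have "filterlim (\<lambda>n. d ^ n) at_top sequentially"
    using d by (intro filterlim_power_nat_at_top) simp
  ultimately have "(\<lambda>n. \<bar>f (tensor_power \<rho> n) - f (\<sigma> n)\<bar> / log 2 (real (d ^ n))) \<longlonglongrightarrow> 0"
    using is_state_tensor_power[OF \<rho>] \<sigma>(1) by (intro continuous_sequence)
  then have "(\<lambda>n. log 2 (real d) * (\<bar>f (tensor_power \<rho> n) - f (\<sigma> n)\<bar> / log 2 (real (d ^ n)))) \<longlonglongrightarrow> log 2 (real d) * 0"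
    by (intro tendsto_mult_left)
  moreover have "log 2 (real d) * (x / log 2 (real (d ^ n))) = x / real n" for x n
  proof -
    have "0 < log 2 (real d)" using d by simp
    from less_imp_neq[OF this, symmetric] show ?thesis using d by (simp add: log_nat_power)
  qed
  ultimately have "(\<lambda>n. \<bar>f (tensor_power \<rho> n) - f (\<sigma> n)\<bar> / real n) \<longlonglongrightarrow> 0" by simp
  then have lim: "(\<lambda>n. f (tensor_power \<pi> (m n)) / real n + \<bar>f (tensor_power \<rho> n) - f (\<sigma> n)\<bar> / real n)
      \<longlonglongrightarrow> regularization f \<pi> * c + 0"
    by (intro tendsto_add regularization_subsequence[OF st\<pi> mtop ratio])
  have "f (tensor_power \<rho> n) / real n
      \<le> f (tensor_power \<pi> (m n)) / real n + \<bar>f (tensor_power \<rho> n) - f (\<sigma> n)\<bar> / real n" if "0 < n" for n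
    unfolding add_divide_distrib[symmetric] using \<sigma>(2)[OF that] by (intro divide_right_mono) auto
  then have "\<exists>N. \<forall>n\<ge>N. f (tensor_power \<rho> n) / real n
      \<le> f (tensor_power \<pi> (m n)) / real n + \<bar>f (tensor_power \<rho> n) - f (\<sigma> n)\<bar> / real n"
    by (intro exI[of _ 1]) simp
  from LIMSEQ_le[OF regularization_tendsto[OF \<rho>] lim this] show ?thesis by (simp add: c_def)
qed

lemma regularization_ge:
  assumes \<rho>: "is_state d \<rho>" and \<pi>: "pure_state 2 \<pi>" and \<epsilon>: "0 < \<epsilon>" "\<epsilon> < information \<rho>"
  shows "regularization f \<pi> * (information \<rho> - \<epsilon>) \<le> regularization f \<rho>"
proof -
  note st\<pi> = pure_qubit_is_state[OF \<pi>]
  define c where "c = information \<rho> - \<epsilon>"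
  have c: "0 < c" using \<epsilon> by (simp add: c_def)
  define m where "m n = nat \<lfloor>real n * c\<rfloor>" for n
  have m: "real n * c - 1 \<le> real (m n)" "real (m n) \<le> real n * c" for n
    using c by (auto simp: m_def)
  have ratio: "(\<lambda>n. real (m n) / real n) \<longlonglongrightarrow> c"
  proof (rule real_tendsto_sandwich)
    have "(\<lambda>n. c - 1 / real n) \<longlonglongrightarrow> c - 0" by (intro tendsto_intros lim_const_over_n)
    then show "(\<lambda>n. c - 1 / real n) \<longlonglongrightarrow> c" by simp
    show "(\<lambda>n. c) \<longlonglongrightarrow> c" by simp
    have "c - 1 / real n \<le> real (m n) / real n" if "0 < n" for n
    proof -
      have "(real n * c - 1) / real n \<le> real (m n) / real n"
        using m(1) by (intro divide_right_mono) auto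
      then show ?thesis using that by (simp add: diff_divide_distrib)
    qed
    then show "eventually (\<lambda>n. c - 1 / real n \<le> real (m n) / real n) sequentially"
      by (intro eventually_mono[OF eventually_gt_at_top[of 0]])
    show "eventually (\<lambda>n. real (m n) / real n \<le> c) sequentially"
      using eventually_gt_at_top[of 0] by eventually_elim (use m(2) in \<open>simp add: field_simps\<close>)
  qed
  have mtop: "filterlim m at_top sequentially" by (rule filterlim_at_top_of_ratio[OF ratio c])
  obtain V where V: "\<And>n \<epsilon> m. 0 < n \<Longrightarrow> 0 < \<epsilon> \<Longrightarrow> real m \<le> real n * (information \<rho> - \<epsilon>) \<Longrightarrow>
    \<exists>L. noisy_op (d ^ n) (2 ^ m) L \<and>
      trace_norm (tensor_power \<pi> m - L (tensor_power \<rho> n)) \<le> V / (real n * \<epsilon>\<^sup>2)"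
    using distill_rate[OF \<rho> \<pi>] by blast
  have "\<exists>\<sigma>. is_state (2 ^ m n) \<sigma> \<and> (0 < n \<longrightarrow> f \<sigma> \<le> f (tensor_power \<rho> n) \<and>
      trace_norm (tensor_power \<pi> (m n) - \<sigma>) \<le> V / (real n * \<epsilon>\<^sup>2))" for n
  proof (cases "0 < n")
    case True
    have "is_state (d ^ n) (tensor_power \<rho> n)" using is_state_tensor_power[OF \<rho>] .
    then show ?thesis
      using V[OF True \<epsilon>(1) m(2)[of n, unfolded c_def]] noisy_op_le noisy_op_state_information by blast
  next
    case False
    then show ?thesis using is_state_tensor_power[OF st\<pi>] by blast
  qed
  then obtain \<sigma> where \<sigma>: "\<And>n. is_state (2 ^ m n) (\<sigma> n)"
    "\<And>n. 0 < n \<Longrightarrow> f (\<sigma> n) \<le> f (tensor_power \<rho> n)"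
    "\<And>n. 0 < n \<Longrightarrow> trace_norm (tensor_power \<pi> (m n) - \<sigma> n) \<le> V / (real n * \<epsilon>\<^sup>2)"
    by metis
  let ?e = "\<lambda>n. \<bar>f (tensor_power \<pi> (m n)) - f (\<sigma> n)\<bar>"
  have "(\<lambda>n. trace_norm (tensor_power \<pi> (m n) - \<sigma> n)) \<longlonglongrightarrow> 0"
  proof (rule real_tendsto_sandwich[OF _ _ tendsto_const])
    have "(\<lambda>n. V / \<epsilon>\<^sup>2 / real n) \<longlonglongrightarrow> 0" by (rule lim_const_over_n)
    then show "(\<lambda>n. V / (real n * \<epsilon>\<^sup>2)) \<longlonglongrightarrow> 0" by (simp add: mult.commute)
    show "eventually (\<lambda>n. 0 \<le> trace_norm (tensor_power \<pi> (m n) - \<sigma> n)) sequentially"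
      using trace_norm_diff_nonneg[OF is_state_tensor_power[OF st\<pi>] \<sigma>(1)] by simp
    show "eventually (\<lambda>n. trace_norm (tensor_power \<pi> (m n) - \<sigma> n) \<le> V / (real n * \<epsilon>\<^sup>2)) sequentially"
      using eventually_gt_at_top[of 0] by eventually_elim (rule \<sigma>(3))
  qed
  moreover have "filterlim (\<lambda>n. 2 ^ m n :: nat) at_top sequentially"
    by (rule filterlim_compose[OF filterlim_power_nat_at_top mtop]) simp
  ultimately have "(\<lambda>n. ?e n / log 2 (real (2 ^ m n))) \<longlonglongrightarrow> 0"
    using is_state_tensor_power[OF st\<pi>] \<sigma>(1) by (intro continuous_sequence)
  then have "(\<lambda>n. ?e n / log 2 (real (2 ^ m n)) * (real (m n) / real n)) \<longlonglongrightarrow> 0 * c"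
    by (intro tendsto_mult ratio)
  moreover have "eventually (\<lambda>n. 1 \<le> m n) sequentially" using mtop by (simp add: filterlim_at_top)
  then have "eventually (\<lambda>n. ?e n / log 2 (real (2 ^ m n)) * (real (m n) / real n) = ?e n / real n) sequentially"
    by eventually_elim (simp add: log_nat_power)
  ultimately have "(\<lambda>n. ?e n / real n) \<longlonglongrightarrow> 0 * c" by (rule Lim_transform_eventually)
  then have lim: "(\<lambda>n. f (tensor_power \<rho> n) / real n + ?e n / real n) \<longlonglongrightarrow> regularization f \<rho> + 0 * c"
    by (intro tendsto_add regularization_tendsto[OF \<rho>])
  have "f (tensor_power \<pi> (m n)) / real n \<le> f (tensor_power \<rho> n) / real n + ?e n / real n"
    if "0 < n" for n
    unfolding add_divide_distrib[symmetric] using \<sigma>(2)[OF that] by (intro divide_right_mono) auto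
  then have "\<exists>N. \<forall>n\<ge>N. f (tensor_power \<pi> (m n)) / real n \<le> f (tensor_power \<rho> n) / real n + ?e n / real n"
    by (intro exI[of _ 1]) simp
  from LIMSEQ_le[OF regularization_subsequence[OF st\<pi> mtop ratio] lim this] show ?thesis
    by (simp add: c_def)
qed

theorem regularization_eq_information:
  assumes \<rho>: "is_state d \<rho>" and \<pi>: "pure_state 2 \<pi>"
  shows "regularization f \<rho> = regularization f \<pi> * information \<rho>"
proof (rule antisym)
  let ?F = "regularization f \<pi>" and ?I = "information \<rho>"
  have lim: "((\<lambda>\<epsilon>. ?F * (?I + \<epsilon>)) \<longlongrightarrow> ?F * (?I + 0)) (at_right 0)"
    "((\<lambda>\<epsilon>. ?F * (?I - \<epsilon>)) \<longlongrightarrow> ?F * (?I - 0)) (at_right 0)"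
    by (intro tendsto_intros)+
  show "?F * ?I \<le> regularization f \<rho>"
  proof (cases "?I = 0")
    case True
    then show ?thesis using regularization_nonneg[OF \<rho>] by simp
  next
    case False
    then have "0 < ?I" using information_nonneg[OF \<rho>] by simp
    then have "eventually (\<lambda>\<epsilon>. ?F * (?I - \<epsilon>) \<le> regularization f \<rho>) (at_right 0)"
      by (intro eventually_at_rightI[of 0 ?I]) (auto intro: regularization_ge[OF \<rho> \<pi>])
    from tendsto_upperbound[OF lim(2) this] show ?thesis by simp
  qed
  show "regularization f \<rho> \<le> ?F * ?I"
  proof (cases "d = 1")
    case True
    then have "is_state 1 \<rho>" using \<rho> by simp
    moreover from this have "?I = 0"
    proof -
      have eq: "\<rho> = unitary_diag 1 (1\<^sub>m 1) (\<lambda>_. 1)"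
        using is_state_oneD[OF \<open>is_state 1 \<rho>\<close>] by (simp add: unitary_diag_one)
      show ?thesis unfolding eq information_unitary_diag[OF is_unitary_one] by (simp add: eta_def)
    qed
    ultimately show ?thesis using regularization_dim_one by simp
  next
    case False
    then have "2 \<le> d" using is_state_dim_pos[OF \<rho>] by simp
    then have "eventually (\<lambda>\<epsilon>. regularization f \<rho> \<le> ?F * (?I + \<epsilon>)) (at_right 0)"
      by (intro eventually_at_rightI[of 0 1]) (auto intro: regularization_le[OF \<rho> _ \<pi>])
    from tendsto_lowerbound[OF lim(1) this] show ?thesis by simp
  qed
qed

end

theorem mainTheorem4:
  shows "nonincreasing_under_NO information \<and>
    asymptotically_continuous information \<and>
    (\<forall>(f :: complex mat \<Rightarrow> real) \<pi>.
       nonincreasing_under_NO f \<longrightarrow>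
       asymptotically_continuous f \<longrightarrow>
       (\<forall>d \<rho>. is_state d \<rho> \<longrightarrow> regularization_exists f \<rho>) \<longrightarrow>
       pure_state 2 \<pi> \<longrightarrow>
       regularization f \<pi> > 0 \<longrightarrow>
       (\<forall>d \<rho>. is_state d \<rho> \<longrightarrow>
          (1 / regularization f \<pi>) * regularization f \<rho> = information \<rho>))"
proof (intro conjI allI impI)
  show "nonincreasing_under_NO information" by (rule information_nonincreasing)
  show "asymptotically_continuous information" by (rule information_asymptotically_continuous)
  fix f :: "complex mat \<Rightarrow> real" and \<pi> d \<rho>
  assume f: "nonincreasing_under_NO f" "asymptotically_continuous f"
    "\<forall>d \<rho>. is_state d \<rho> \<longrightarrow> regularization_exists f \<rho>"
    and \<pi>: "pure_state 2 \<pi>" "regularization f \<pi> > 0" and \<rho>: "is_state d \<rho>"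
  interpret continuous_monotone f by unfold_locales (use f in auto)
  show "(1 / regularization f \<pi>) * regularization f \<rho> = information \<rho>"
    using regularization_eq_information[OF \<rho> \<pi>(1)] \<pi>(2) by simp
qed

end
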